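(* Let $\alpha>1$ be a constant, let $(M,g)$ be a compact Riemannian manifold without boundary, let $\mathbb{S}^n\subset\mathbb{R}^{n+1}$ be the standard unit sphere, and let $\psi:(M,g)\to\mathbb{S}^{n}$ be an $\alpha$-harmonic map such that $$|d\psi|^{2}<\frac{n-2}{2\alpha-n}.$$ Then $\psi$ is unstable.
   Context: For a smooth map $\psi:(M,g)\to(N,h)$, $|d\psi|$ denotes the Hilbert–Schmidt norm of $d\psi$ with respect to $g$ and $h$ (here $N=\mathbb{S}^n$ with its standard metric). For a constant $\alpha>1$, $\psi$ is $\alpha$-harmonic if it is a critical point (with respect to smooth variations) of $E_\alpha(\psi)=\int_M(1+|d\psi|^2)^\alpha\,dV_g$. For an $\alpha$-harmonic map $\psi$ and a smooth 2-parameter variation $\{\psi_{t,s}:M\to N\}_{-\epsilon<s,t<\epsilon}$ with $\psi_{0,0}=\psi$, $\upsilon=\frac{\partial\psi_{t,s}}{\partial t}\big|_{s=t=0}$ and $\omega=\frac{\partial\psi_{t,s}}{\partial s}\big|_{s=t=0}$, set $I(\upsilon,\omega)=\frac{\partial^2}{\partial t\,\partial s}E_\alpha(\psi_{t,s})\big|_{s=t=0}$ (this depends only on $\upsilon,\omega\in\Gamma(\psi^{-1}TN)$). The $\alpha$-harmonic map $\psi$ is stable if $I(\upsilon,\upsilon)\ge0$ for every compactly supported vector field $\upsilon$ along $\psi$, and unstable if it is not stable. The inequality on $|d\psi|^2$ is required at every point of $M$.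
   Formalization: The formal theorem also assumes that dψ is not identically zero; without this, a constant map (with n > 2 and 2α > n) satisfies the hypotheses but is an absolute minimum of the α-energy and hence stable. *)

theory Defs
  imports "HOL-Analysis.Analysis"
begin

section \<open>Smooth maps on open subsets of normed spaces\<close>

text \<open>A function is of class C^k on an open set if it is k times differentiable there, all iterated
  directional derivatives being continuous; only its values on the (open) set matter.\<close>

primrec C_k_on ::
  "nat \<Rightarrow> ('a::real_normed_vector) set \<Rightarrow> ('a \<Rightarrow> 'b::real_normed_vector) \<Rightarrow> bool" where
  "C_k_on 0 S f \<longleftrightarrow> continuous_on S f"
| "C_k_on (Suc k) S f \<longleftrightarrow> (\<forall>x\<in>S. f differentiable (at x)) \<and>
     (\<forall>v. C_k_on k S (\<lambda>x. frechet_derivative f (at x) v))"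

definition smooth_on ::
  "('a::real_normed_vector) set \<Rightarrow> ('a \<Rightarrow> 'b::real_normed_vector) \<Rightarrow> bool" where
  "smooth_on S f \<longleftrightarrow> (\<forall>k. C_k_on k S f)"

section \<open>Smooth manifolds and Riemannian metrics\<close>

text \<open>A manifold is a subset \<open>M\<close> of a Hausdorff space, with the subspace topology, together with a
  smooth atlas \<open>A\<close>.  Charts take values in open subsets of \<open>real ^ 'm\<close>, so there is no boundary.
  The linear order on the index type \<open>'m\<close> carries no meaning; the change of variables
  theorem for \<open>real ^ 'm\<close> requires it.\<close>

type_synonym ('a, 'm) chart = "'a set \<times> ('a \<Rightarrow> real ^ 'm)"

abbreviation chart_dom :: "('a, 'm) chart \<Rightarrow> 'a set" where
  "chart_dom \<equiv> fst"

abbreviation chart_map :: "('a, 'm) chart \<Rightarrow> 'a \<Rightarrow> real ^ 'm" where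
  "chart_map \<equiv> snd"

abbreviation chart_ran :: "('a, 'm) chart \<Rightarrow> (real ^ 'm) set" where
  "chart_ran c \<equiv> chart_map c ` chart_dom c"

abbreviation chart_inv :: "('a, 'm) chart \<Rightarrow> real ^ 'm \<Rightarrow> 'a" where
  "chart_inv c \<equiv> inv_into (chart_dom c) (chart_map c)"

definition smooth_atlas ::
  "('a::t2_space) set \<Rightarrow> ('a, 'm::{finite, wellorder}) chart set \<Rightarrow> bool" where
  "smooth_atlas M A \<longleftrightarrow>
     (\<Union>c\<in>A. chart_dom c) = M \<and>
     (\<forall>c\<in>A. openin (top_of_set M) (chart_dom c) \<and> open (chart_ran c) \<and>
        homeomorphism (chart_dom c) (chart_ran c) (chart_map c) (chart_inv c)) \<and>
     (\<forall>c\<in>A. \<forall>d\<in>A. smooth_on (chart_map c ` (chart_dom c \<inter> chart_dom d))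
        (chart_map d \<circ> chart_inv c))"

text \<open>A Riemannian metric is given by its Gram matrices \<open>g c p\<close> of the coordinate frames at \<open>p\<close>,
  one for each chart \<open>c\<close> around \<open>p\<close>, subject to the transformation law of covariant 2-tensors.\<close>

type_synonym ('a, 'm) metric = "('a, 'm) chart \<Rightarrow> 'a \<Rightarrow> real ^ 'm ^ 'm"

definition transition_jacobian ::
  "('a, 'm::{finite, wellorder}) chart \<Rightarrow> ('a, 'm) chart \<Rightarrow> 'a \<Rightarrow> real ^ 'm::_ ^ 'm::_" where
  "transition_jacobian c d p =
     matrix (frechet_derivative (chart_map d \<circ> chart_inv c) (at (chart_map c p)))"

definition riemannian_metric ::
  "('a, 'm::{finite, wellorder}) chart set \<Rightarrow> ('a, 'm) metric \<Rightarrow> bool" where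
  "riemannian_metric A g \<longleftrightarrow>
     (\<forall>c\<in>A. smooth_on (chart_ran c) (g c \<circ> chart_inv c)) \<and>
     (\<forall>c\<in>A. \<forall>p\<in>chart_dom c. transpose (g c p) = g c p \<and>
        (\<forall>v. v \<noteq> 0 \<longrightarrow> v \<bullet> (g c p *v v) > 0)) \<and>
     (\<forall>c\<in>A. \<forall>d\<in>A. \<forall>p\<in>chart_dom c \<inter> chart_dom d.
        g c p = transpose (transition_jacobian c d p) ** g d p ** transition_jacobian c d p)"

text \<open>The Riemannian volume measure is the Borel measure on \<open>M\<close> whose density in each chart is
  the square root of the determinant of the Gram matrix.\<close>

definition is_riemannian_volume ::
  "('a::t2_space) set \<Rightarrow> ('a, 'm::{finite, wellorder}) chart set \<Rightarrow> ('a, 'm) metric \<Rightarrow>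
     'a measure \<Rightarrow> bool" where
  "is_riemannian_volume M A g \<mu> \<longleftrightarrow>
     sets \<mu> = sets (restrict_space borel M) \<and>
     (\<forall>c\<in>A. \<forall>B\<in>sets \<mu>. B \<subseteq> chart_dom c \<longrightarrow>
        emeasure \<mu> B =
          (\<integral>\<^sup>+ x\<in>chart_map c ` B. ennreal (sqrt (det (g c (chart_inv c x)))) \<partial>lborel))"

definition riemannian_volume ::
  "('a::t2_space) set \<Rightarrow> ('a, 'm::{finite, wellorder}) chart set \<Rightarrow> ('a, 'm) metric \<Rightarrow>
     'a measure" where
  "riemannian_volume M A g = (THE \<mu>. is_riemannian_volume M A g \<mu>)"

section \<open>Maps into the unit sphere\<close>

text \<open>Maps into the unit sphere of the Euclidean space \<open>'b\<close> are treated as \<open>'b\<close>-valued maps; the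
  sphere carries the smooth structure and the metric induced from \<open>'b\<close>.\<close>

definition smooth_map_to_sphere ::
  "('a::t2_space) set \<Rightarrow> ('a, 'm::{finite, wellorder}) chart set \<Rightarrow>
     ('a \<Rightarrow> 'b::euclidean_space) \<Rightarrow> bool" where
  "smooth_map_to_sphere M A \<psi> \<longleftrightarrow>
     \<psi> \<in> M \<rightarrow> sphere 0 1 \<and> (\<forall>c\<in>A. smooth_on (chart_ran c) (\<psi> \<circ> chart_inv c))"

definition partial_deriv ::
  "('a, 'm::{finite, wellorder}) chart \<Rightarrow> ('a \<Rightarrow> 'b::euclidean_space) \<Rightarrow> 'a \<Rightarrow> 'm \<Rightarrow> 'b" where
  "partial_deriv c \<psi> p i =
     frechet_derivative (\<psi> \<circ> chart_inv c) (at (chart_map c p)) (axis i 1)"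

text \<open>The squared Hilbert-Schmidt norm of the differential, that is, the sum over \<open>i\<close>, \<open>j\<close> of
  \<open>g^{ij} h(\<partial>_i \<psi>, \<partial>_j \<psi>)\<close> in a chart around \<open>p\<close>; it does not depend on the chart.\<close>

definition norm_sq_differential ::
  "('a, 'm::{finite, wellorder}) chart set \<Rightarrow> ('a, 'm) metric \<Rightarrow>
     ('a \<Rightarrow> 'b::euclidean_space) \<Rightarrow> 'a \<Rightarrow> real" where
  "norm_sq_differential A g \<psi> p =
     (let c = (SOME c. c \<in> A \<and> p \<in> chart_dom c) in
      \<Sum>i\<in>UNIV. \<Sum>j\<in>UNIV.
        matrix_inv (g c p) $ i $ j * (partial_deriv c \<psi> p i \<bullet> partial_deriv c \<psi> p j))"

section \<open>\<open>\<alpha>\<close>-harmonic maps and their stability\<close>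

definition alpha_energy ::
  "real \<Rightarrow> ('a::t2_space) set \<Rightarrow> ('a, 'm::{finite, wellorder}) chart set \<Rightarrow> ('a, 'm) metric \<Rightarrow>
     ('a \<Rightarrow> 'b::euclidean_space) \<Rightarrow> real" where
  "alpha_energy \<alpha> M A g \<psi> =
     (\<integral>p. (1 + norm_sq_differential A g \<psi> p) powr \<alpha> \<partial>riemannian_volume M A g)"

definition smooth_variation ::
  "('a::t2_space) set \<Rightarrow> ('a, 'm::{finite, wellorder}) chart set \<Rightarrow>
     ('a \<Rightarrow> 'b::euclidean_space) \<Rightarrow> real \<Rightarrow> (real \<Rightarrow> 'a \<Rightarrow> 'b) \<Rightarrow> bool" where
  "smooth_variation M A \<psi> \<epsilon> \<Psi> \<longleftrightarrow> \<epsilon> > 0 \<and>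
     (\<forall>t\<in>{-\<epsilon><..<\<epsilon>}. \<Psi> t \<in> M \<rightarrow> sphere 0 1) \<and>
     (\<forall>c\<in>A. smooth_on ({-\<epsilon><..<\<epsilon>} \<times> chart_ran c) (\<lambda>(t, x). \<Psi> t (chart_inv c x))) \<and>
     (\<forall>p\<in>M. \<Psi> 0 p = \<psi> p)"

definition smooth_variation2 ::
  "('a::t2_space) set \<Rightarrow> ('a, 'm::{finite, wellorder}) chart set \<Rightarrow>
     ('a \<Rightarrow> 'b::euclidean_space) \<Rightarrow> real \<Rightarrow> (real \<Rightarrow> real \<Rightarrow> 'a \<Rightarrow> 'b) \<Rightarrow> bool" where
  "smooth_variation2 M A \<psi> \<epsilon> \<Psi> \<longleftrightarrow> \<epsilon> > 0 \<and>
     (\<forall>t\<in>{-\<epsilon><..<\<epsilon>}. \<forall>s\<in>{-\<epsilon><..<\<epsilon>}. \<Psi> t s \<in> M \<rightarrow> sphere 0 1) \<and>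
     (\<forall>c\<in>A. smooth_on ({-\<epsilon><..<\<epsilon>} \<times> {-\<epsilon><..<\<epsilon>} \<times> chart_ran c)
        (\<lambda>(t, s, x). \<Psi> t s (chart_inv c x))) \<and>
     (\<forall>p\<in>M. \<Psi> 0 0 p = \<psi> p)"

definition alpha_harmonic ::
  "real \<Rightarrow> ('a::t2_space) set \<Rightarrow> ('a, 'm::{finite, wellorder}) chart set \<Rightarrow> ('a, 'm) metric \<Rightarrow>
     ('a \<Rightarrow> 'b::euclidean_space) \<Rightarrow> bool" where
  "alpha_harmonic \<alpha> M A g \<psi> \<longleftrightarrow> smooth_map_to_sphere M A \<psi> \<and>
     (\<forall>\<epsilon> \<Psi>. smooth_variation M A \<psi> \<epsilon> \<Psi> \<longrightarrow>
        ((\<lambda>t. alpha_energy \<alpha> M A g (\<Psi> t)) has_real_derivative 0) (at 0))"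

definition vector_field_along ::
  "('a::t2_space) set \<Rightarrow> ('a, 'm::{finite, wellorder}) chart set \<Rightarrow>
     ('a \<Rightarrow> 'b::euclidean_space) \<Rightarrow> ('a \<Rightarrow> 'b) \<Rightarrow> bool" where
  "vector_field_along M A \<psi> v \<longleftrightarrow>
     (\<forall>p\<in>M. v p \<bullet> \<psi> p = 0) \<and> (\<forall>c\<in>A. smooth_on (chart_ran c) (v \<circ> chart_inv c))"

definition compactly_supported :: "('a::t2_space) set \<Rightarrow> ('a \<Rightarrow> 'b::zero) \<Rightarrow> bool" where
  "compactly_supported M v \<longleftrightarrow> compact (M \<inter> closure {p \<in> M. v p \<noteq> 0})"

text \<open>\<open>second_variation \<alpha> M A g \<psi> v w r\<close> states \<open>I(v, w) = r\<close>: the number \<open>r\<close> is the mixed second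
  derivative of the energy along a two-parameter variation with variation fields \<open>v\<close> and \<open>w\<close>.
  For an \<open>\<alpha>\<close>-harmonic \<open>\<psi>\<close> the value does not depend on the variation.\<close>

definition second_variation ::
  "real \<Rightarrow> ('a::t2_space) set \<Rightarrow> ('a, 'm::{finite, wellorder}) chart set \<Rightarrow> ('a, 'm) metric \<Rightarrow>
     ('a \<Rightarrow> 'b::euclidean_space) \<Rightarrow> ('a \<Rightarrow> 'b) \<Rightarrow> ('a \<Rightarrow> 'b) \<Rightarrow> real \<Rightarrow> bool" where
  "second_variation \<alpha> M A g \<psi> v w r \<longleftrightarrow>
     (\<exists>\<epsilon> \<Psi>. smooth_variation2 M A \<psi> \<epsilon> \<Psi> \<and>
        (\<forall>p\<in>M. ((\<lambda>t. \<Psi> t 0 p) has_vector_derivative v p) (at 0)) \<and>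
        (\<forall>p\<in>M. ((\<lambda>s. \<Psi> 0 s p) has_vector_derivative w p) (at 0)) \<and>
        r = deriv (\<lambda>t. deriv (\<lambda>s. alpha_energy \<alpha> M A g (\<Psi> t s)) 0) 0)"

definition stable ::
  "real \<Rightarrow> ('a::t2_space) set \<Rightarrow> ('a, 'm::{finite, wellorder}) chart set \<Rightarrow> ('a, 'm) metric \<Rightarrow>
     ('a \<Rightarrow> 'b::euclidean_space) \<Rightarrow> bool" where
  "stable \<alpha> M A g \<psi> \<longleftrightarrow>
     (\<forall>v r. vector_field_along M A \<psi> v \<and> compactly_supported M v \<and>
        second_variation \<alpha> M A g \<psi> v v r \<longrightarrow> r \<ge> 0)"

abbreviation unstable ::
  "real \<Rightarrow> ('a::t2_space) set \<Rightarrow> ('a, 'm::{finite, wellorder}) chart set \<Rightarrow> ('a, 'm) metric \<Rightarrow>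
     ('a \<Rightarrow> 'b::euclidean_space) \<Rightarrow> bool" where
  "unstable \<alpha> M A g \<psi> \<equiv> \<not> stable \<alpha> M A g \<psi>"

section \<open>Existence and uniqueness of the Riemannian volume measure\<close>

lemma nn_integral_set_eq_integral:
  fixes f :: "real ^ 'm::{finite, wellorder} \<Rightarrow> real"
  assumes m: "(\<lambda>x. indicator S x * f x) \<in> borel_measurable borel" and nn: "\<And>x. f x \<ge> 0"
  shows "(\<integral>\<^sup>+ x\<in>S. ennreal (f x) \<partial>lborel) =
    (if f absolutely_integrable_on S then ennreal (integral S f) else \<infinity>)"
proof -
  let ?h = "\<lambda>x. indicator S x * f x"
  have eq: "(\<integral>\<^sup>+ x\<in>S. ennreal (f x) \<partial>lborel) = (\<integral>\<^sup>+ x. ennreal (?h x) \<partial>lebesgue)"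
    unfolding nn_integral_completion by (intro nn_integral_cong) (auto simp: indicator_def)
  have ml: "?h \<in> borel_measurable lebesgue"
    using m by (simp add: measurable_completion)
  show ?thesis
  proof (cases "f absolutely_integrable_on S")
    case True
    then have i: "integrable lebesgue ?h" by (simp add: set_integrable_def)
    have "(\<integral>\<^sup>+ x. ennreal (?h x) \<partial>lebesgue) = ennreal (integral\<^sup>L lebesgue ?h)"
      by (rule nn_integral_eq_integral[OF i]) (use nn in auto)
    also have "integral\<^sup>L lebesgue ?h = integral S f"
      using set_lebesgue_integral_eq_integral(2)[OF True] by (simp add: set_lebesgue_integral_def)
    finally show ?thesis using True eq by simp
  next
    case False
    then have "\<not> integrable lebesgue ?h" by (simp add: set_integrable_def)
    then have "(\<integral>\<^sup>+ x. ennreal (?h x) \<partial>lebesgue) = \<infinity>"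
      using ml nn by (subst (asm) integrable_iff_bounded) (auto simp: not_less top_unique abs_mult)
    then show ?thesis using False eq by simp
  qed
qed

lemma nn_integral_change_of_variables:
  fixes f h :: "real ^ 'm::{finite, wellorder} \<Rightarrow> real" and T :: "real ^ 'm::_ \<Rightarrow> real ^ 'm::_"
  assumes S: "S \<in> sets borel"
    and der: "\<And>x. x \<in> S \<Longrightarrow> (T has_derivative T' x) (at x)" and inj: "inj_on T S"
    and mf: "(\<lambda>x. indicator (T ` S) x * f x) \<in> borel_measurable borel"
    and mh: "(\<lambda>x. indicator S x * h x) \<in> borel_measurable borel"
    and nn: "\<And>x. f x \<ge> 0" "\<And>x. h x \<ge> 0"
    and h: "\<And>x. x \<in> S \<Longrightarrow> h x = \<bar>det (matrix (T' x))\<bar> * f (T x)"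
  shows "(\<integral>\<^sup>+ x\<in>T ` S. ennreal (f x) \<partial>lborel) = (\<integral>\<^sup>+ x\<in>S. ennreal (h x) \<partial>lborel)"
proof -
  have Sl: "S \<in> sets lebesgue" using S by (simp add: sets_completionI_sets)
  have der': "\<And>x. x \<in> S \<Longrightarrow> (T has_derivative T' x) (at x within S)"
    using der has_derivative_at_withinI by blast
  let ?v = "\<lambda>x. (vec (f x) :: real ^ 1)"
  have cov: "(\<lambda>x. \<bar>det (matrix (T' x))\<bar> *\<^sub>R ?v (T x)) absolutely_integrable_on S \<and>
      integral S (\<lambda>x. \<bar>det (matrix (T' x))\<bar> *\<^sub>R ?v (T x)) = vec b
    \<longleftrightarrow> ?v absolutely_integrable_on (T ` S) \<and> integral (T ` S) ?v = (vec b :: real ^ 1)" for b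
    by (rule has_absolute_integral_change_of_variables[OF Sl der' inj])
  have c: "h absolutely_integrable_on S \<longleftrightarrow>
      (\<lambda>x. \<bar>det (matrix (T' x))\<bar> * f (T x)) absolutely_integrable_on S"
    by (intro set_integrable_cong) (auto simp: h)
  have c2: "integral S h = integral S (\<lambda>x. \<bar>det (matrix (T' x))\<bar> * f (T x))"
    by (intro Henstock_Kurzweil_Integration.integral_cong) (auto simp: h)
  have cov': "h absolutely_integrable_on S \<and> integral S h = b
    \<longleftrightarrow> f absolutely_integrable_on (T ` S) \<and> integral (T ` S) f = b" for b
    using cov[of b] unfolding c c2
    by (auto simp: absolutely_integrable_on_1_iff integral_on_1_eq o_def vec_eq_iff)
  show ?thesis
    unfolding nn_integral_set_eq_integral[OF mf nn(1)] nn_integral_set_eq_integral[OF mh nn(2)]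
    using cov'[of "integral S h"] cov'[of "integral (T ` S) f"] by auto
qed

lemma suminf_swap_ennreal:
  fixes f :: "nat \<Rightarrow> nat \<Rightarrow> ennreal"
  shows "(\<Sum>i. \<Sum>j. f i j) = (\<Sum>j. \<Sum>i. f i j)"
proof -
  have "(\<Sum>i. \<Sum>j. f i j) = (\<Sum>i. \<integral>\<^sup>+ j. f i j \<partial>count_space UNIV)"
    by (simp add: nn_integral_count_space_nat)
  also have "\<dots> = (\<integral>\<^sup>+ j. (\<Sum>i. f i j) \<partial>count_space UNIV)"
    by (rule nn_integral_suminf[symmetric]) simp
  finally show ?thesis by (simp add: nn_integral_count_space_nat)
qed

lemma smooth_on_imp_continuous_on: "smooth_on S f \<Longrightarrow> continuous_on S f"
  unfolding smooth_on_def by (metis C_k_on.simps(1))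

lemma smooth_on_imp_differentiable: "smooth_on S f \<Longrightarrow> x \<in> S \<Longrightarrow> f differentiable (at x)"
  unfolding smooth_on_def by (metis C_k_on.simps(2))

lemma smooth_atlasD:
  assumes "smooth_atlas M A" "c \<in> A"
  shows "chart_dom c \<subseteq> M" "openin (top_of_set M) (chart_dom c)" "open (chart_ran c)"
    "inj_on (chart_map c) (chart_dom c)" "continuous_on (chart_dom c) (chart_map c)"
    "continuous_on (chart_ran c) (chart_inv c)"
    "\<And>p. p \<in> chart_dom c \<Longrightarrow> chart_inv c (chart_map c p) = p"
    "\<And>x. x \<in> chart_ran c \<Longrightarrow> chart_map c (chart_inv c x) = x"
    "\<And>x. x \<in> chart_ran c \<Longrightarrow> chart_inv c x \<in> chart_dom c"
proof -
  have A: "(\<Union>c\<in>A. chart_dom c) = M" "openin (top_of_set M) (chart_dom c)" "open (chart_ran c)"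
    and h: "homeomorphism (chart_dom c) (chart_ran c) (chart_map c) (chart_inv c)"
    using assms unfolding smooth_atlas_def by blast+
  show "chart_dom c \<subseteq> M" using A(1) assms(2) by blast
  show "openin (top_of_set M) (chart_dom c)" "open (chart_ran c)" by fact+
  show inv: "chart_inv c (chart_map c p) = p" if "p \<in> chart_dom c" for p
    using homeomorphism_apply1[OF h that] .
  show "inj_on (chart_map c) (chart_dom c)" by (rule inj_on_inverseI) (rule inv)
  show "continuous_on (chart_dom c) (chart_map c)" "continuous_on (chart_ran c) (chart_inv c)"
    using homeomorphism_cont1[OF h] homeomorphism_cont2[OF h] .
  show "chart_map c (chart_inv c x) = x" "chart_inv c x \<in> chart_dom c" if "x \<in> chart_ran c" for x
    using f_inv_into_f[OF that] inv_into_into[OF that] .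
qed

lemma borel_chart_image:
  assumes M: "compact M" and A: "smooth_atlas M A" and c: "c \<in> A"
    and B: "B \<in> sets (restrict_space borel M)" "B \<subseteq> chart_dom c"
  shows "chart_map c ` B \<in> sets borel"
proof -
  note D = smooth_atlasD[OF A c]
  have Bb: "B \<in> sets borel"
    using B(1) compact_imp_closed[OF M] by (auto simp: sets_restrict_space_iff)
  have "chart_inv c \<in> borel_measurable (restrict_space borel (chart_ran c))"
    by (rule borel_measurable_continuous_on_restrict[OF D(6)])
  from measurable_sets[OF this Bb]
  have "chart_inv c -` B \<inter> chart_ran c \<in> sets borel"
    using D(3) by (auto simp: space_restrict_space sets_restrict_space_iff)
  also have "chart_inv c -` B \<inter> chart_ran c = chart_map c ` B"
    using B(2) D(7,8) by (auto simp: image_iff subset_iff)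
  finally show ?thesis .
qed

lemma continuous_on_matrix_det:
  fixes f :: "'x::topological_space \<Rightarrow> real ^ 'm ^ 'm"
  assumes f: "continuous_on S f"
  shows "continuous_on S (\<lambda>x. det (f x))"
proof -
  have "continuous_on S (\<lambda>x. f x $ i $ j)" for i j
    by (rule continuous_on_component[OF continuous_on_component[OF f]])
  then show ?thesis
    unfolding det_def
    by (intro continuous_on_sum continuous_on_mult continuous_on_const continuous_on_prod)
qed

lemma borel_measurable_volume_density:
  fixes A :: "('a::t2_space, 'm::{finite, wellorder}) chart set"
  assumes A: "smooth_atlas M A" and g: "riemannian_metric A g" and c: "c \<in> A"
  shows "(\<lambda>x. indicator (chart_ran c) x * sqrt (det (g c (chart_inv c x)))) \<in> borel_measurable borel"
proof -
  have "continuous_on (chart_ran c) (\<lambda>x. sqrt (det (g c (chart_inv c x))))"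
  proof (intro continuous_on_real_sqrt continuous_on_matrix_det)
    have "smooth_on (chart_ran c) (g c \<circ> chart_inv c)"
      using g c by (simp add: riemannian_metric_def)
    from smooth_on_imp_continuous_on[OF this]
    show "continuous_on (chart_ran c) (\<lambda>x. g c (chart_inv c x))" by (simp add: o_def)
  qed
  from borel_measurable_continuous_on_indicator[OF _ this] smooth_atlasD(3)[OF A c]
  show ?thesis by (simp add: borel_open)
qed

lemma volume_density_overlap:
  fixes A :: "('a::t2_space, 'm::{finite, wellorder}) chart set"
  assumes M: "compact M" and A: "smooth_atlas M A" and g: "riemannian_metric A g"
    and c: "c \<in> A" and d: "d \<in> A"
    and B: "B \<in> sets (restrict_space borel M)" "B \<subseteq> chart_dom c" "B \<subseteq> chart_dom d"
  shows "(\<integral>\<^sup>+ x\<in>chart_map d ` B. ennreal (sqrt (det (g d (chart_inv d x)))) \<partial>lborel) =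
    (\<integral>\<^sup>+ x\<in>chart_map c ` B. ennreal (sqrt (det (g c (chart_inv c x)))) \<partial>lborel)"
proof -
  note C = smooth_atlasD[OF A c] and D = smooth_atlasD[OF A d]
  let ?T = "chart_map d \<circ> chart_inv c" and ?S = "chart_map c ` B"
  let ?W = "\<lambda>c x. sqrt (det (g c (chart_inv c x)))"
  have TS: "?T ` ?S = chart_map d ` B"
    unfolding image_image o_def using B(2) C(7) by (intro image_cong) auto
  have meas: "(\<lambda>x. indicator (chart_map c ` B) x * max 0 (?W c x)) \<in> borel_measurable borel"
    if "c \<in> A" "B \<subseteq> chart_dom c" for c
  proof -
    have "(\<lambda>x. indicator (chart_map c ` B) x * max 0 (indicator (chart_ran c) x * ?W c x))
      \<in> borel_measurable borel"
      using borel_chart_image[OF M A that(1) B(1) that(2)]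
        borel_measurable_volume_density[OF A g that(1)] by measurable
    also have "(\<lambda>x. indicator (chart_map c ` B) x * max 0 (indicator (chart_ran c) x * ?W c x)) =
      (\<lambda>x. indicator (chart_map c ` B) x * max 0 (?W c x))"
      using that(2) by (auto simp: indicator_def fun_eq_iff)
    finally show ?thesis .
  qed
  have der: "(?T has_derivative frechet_derivative ?T (at x)) (at x)" if "x \<in> ?S" for x
  proof -
    have "smooth_on (chart_map c ` (chart_dom c \<inter> chart_dom d)) ?T"
      using A c d by (auto simp: smooth_atlas_def)
    then show ?thesis
      using smooth_on_imp_differentiable that B frechet_derivative_works by blast
  qed
  have inj: "inj_on ?T ?S"
  proof (rule inj_onI)
    fix x y assume "x \<in> ?S" "y \<in> ?S" and eq: "?T x = ?T y"
    then obtain p q where pq: "p \<in> B" "q \<in> B" "x = chart_map c p" "y = chart_map c q" by auto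
    then have "chart_inv c x = p" "chart_inv c y = q" using B(2) C(7) by auto
    with eq have "chart_map d p = chart_map d q" by simp
    then have "p = q" using inj_onD[OF D(4)] pq(1,2) B(3) by blast
    with pq show "x = y" by simp
  qed
  have dens: "max 0 (?W c x) =
      \<bar>det (matrix (frechet_derivative ?T (at x)))\<bar> * max 0 (?W d (?T x))" if x: "x \<in> ?S" for x
  proof -
    obtain p where p: "p \<in> B" "x = chart_map c p" using x by auto
    let ?J = "transition_jacobian c d p"
    have "g c p = transpose ?J ** g d p ** ?J"
      using g c d p(1) B(2,3) unfolding riemannian_metric_def by blast
    then have "det (g c p) = (det ?J)\<^sup>2 * det (g d p)"
      by (simp add: det_mul power2_eq_square)
    then have "sqrt (det (g c p)) = \<bar>det ?J\<bar> * sqrt (det (g d p))"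
      by (simp add: real_sqrt_mult)
    moreover have "?T x = chart_map d p" "chart_inv c x = p" "chart_inv d (chart_map d p) = p"
      using p B C(7) D(7) by auto
    moreover have "max 0 (\<bar>k\<bar> * w) = \<bar>k\<bar> * max 0 w" for k w :: real
      by (auto simp: max_def mult_le_0_iff zero_le_mult_iff not_le)
    ultimately show ?thesis using p by (simp add: transition_jacobian_def)
  qed
  have "(\<integral>\<^sup>+ x\<in>?T ` ?S. ennreal (max 0 (?W d x)) \<partial>lborel) =
    (\<integral>\<^sup>+ x\<in>?S. ennreal (max 0 (?W c x)) \<partial>lborel)"
    using meas[OF d B(3)] meas[OF c B(2)] TS
    by (intro nn_integral_change_of_variables[OF _ der inj] dens)
      (auto intro!: borel_chart_image[OF M A c B(1,2)])
  then show ?thesis unfolding TS by (simp add: ennreal_max_0)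
qed

lemma countable_disjoint_chart_cover:
  assumes M: "compact M" and A: "smooth_atlas M A" and ne: "A \<noteq> {}"
  obtains c D where "\<And>i::nat. c i \<in> A" "\<And>i. D i \<in> sets (restrict_space borel M)"
    "\<And>i. D i \<subseteq> chart_dom (c i)" "disjoint_family D" "(\<Union>i. D i) = M"
proof -
  have "\<forall>c\<in>A. \<exists>T. open T \<and> chart_dom c = M \<inter> T"
    using smooth_atlasD(2)[OF A] by (auto simp: openin_open)
  then obtain T where T: "\<And>c. c \<in> A \<Longrightarrow> open (T c)" "\<And>c. c \<in> A \<Longrightarrow> chart_dom c = M \<inter> T c"
    by metis
  have un: "(\<Union>c\<in>A. chart_dom c) = M" using A by (simp add: smooth_atlas_def)
  then have "M \<subseteq> (\<Union>c\<in>A. T c)" using T(2) by auto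
  then obtain C where C: "C \<subseteq> A" "finite C" "M \<subseteq> (\<Union>c\<in>C. T c)"
    using compactE_image[OF M] T(1) by metis
  obtain a where a: "a \<in> A" using ne by auto
  define c where "c = from_nat_into (insert a C)"
  have rc: "range c = insert a C"
    unfolding c_def using C(2) by (intro range_from_nat_into) (auto intro: countable_finite)
  have cA: "c i \<in> A" for i
    using rangeI[of c i] C(1) a unfolding rc by auto
  have dom: "chart_dom (c i) \<in> sets (restrict_space borel M)" for i
    using T(1)[OF cA[of i]] T(2)[OF cA[of i]] by (auto simp: sets_restrict_space)
  show thesis
  proof (rule that[of c "disjointed (\<lambda>i. chart_dom (c i))"])
    show "disjointed (\<lambda>i. chart_dom (c i)) i \<in> sets (restrict_space borel M)" for i
      using dom sets.range_disjointed_sets[of "\<lambda>i. chart_dom (c i)" "restrict_space borel M"]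
      by blast
    have "(\<Union>i. chart_dom (c i)) = M"
    proof
      show "(\<Union>i. chart_dom (c i)) \<subseteq> M" using un cA by blast
      show "M \<subseteq> (\<Union>i. chart_dom (c i))"
      proof
        fix p assume p: "p \<in> M"
        then obtain d where d: "d \<in> C" "p \<in> T d" using C(3) by auto
        then obtain i where "c i = d" using rc by (metis insertI2 rangeE)
        then show "p \<in> (\<Union>i. chart_dom (c i))" using T(2)[OF cA[of i]] p d by auto
      qed
    qed
    then show "(\<Union>i. disjointed (\<lambda>i. chart_dom (c i)) i) = M"
      by (simp add: UN_disjointed_eq)
    show "disjointed (\<lambda>i. chart_dom (c i)) i \<subseteq> chart_dom (c i)" for i
      by (rule disjointed_subset)
    show "disjoint_family (disjointed (\<lambda>i. chart_dom (c i)))" by (rule disjoint_family_disjointed)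
  qed (rule cA)
qed

theorem ex1_riemannian_volume:
  fixes A :: "('a::t2_space, 'm::{finite, wellorder}) chart set"
  assumes M: "compact M" and A: "smooth_atlas M A" and g: "riemannian_metric A g"
  shows "\<exists>!\<mu>. is_riemannian_volume M A g \<mu>"
proof (cases "A = {}")
  case True
  then have "M = {}" using A by (simp add: smooth_atlas_def)
  then have s: "sets (restrict_space borel M) = {{}}" by (auto simp: sets_restrict_space)
  show ?thesis
  proof (rule ex1I[of _ "restrict_space borel M"])
    show "is_riemannian_volume M A g (restrict_space borel M)"
      using True by (simp add: is_riemannian_volume_def)
    fix \<mu> assume \<mu>: "is_riemannian_volume M A g \<mu>"
    show "\<mu> = restrict_space borel M"
      by (rule measure_eqI) (use \<mu> s in \<open>auto simp: is_riemannian_volume_def\<close>)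
  qed
next
  case False
  let ?R = "restrict_space borel M"
  define \<nu> where "\<nu> c E = (\<integral>\<^sup>+ x\<in>chart_map c ` E.
    ennreal (sqrt (det (g c (chart_inv c x)))) \<partial>lborel)" for c and E :: "'a set"
  have \<nu>_add: "(\<Sum>n. \<nu> c (E n)) = \<nu> c (\<Union>n. E n)"
    if c: "c \<in> A" and E: "\<And>n. E n \<in> sets ?R" "\<And>n. E n \<subseteq> chart_dom c" "disjoint_family E"
    for c and E :: "nat \<Rightarrow> 'a set"
  proof -
    let ?W = "\<lambda>x. ennreal (indicator (chart_ran c) x * sqrt (det (g c (chart_inv c x))))"
    have W: "?W \<in> borel_measurable lborel"
      using borel_measurable_volume_density[OF A g c] by simp
    have \<nu>: "\<nu> c F = emeasure (density lborel ?W) (chart_map c ` F)"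
      if F: "F \<in> sets ?R" "F \<subseteq> chart_dom c" for F
    proof -
      have "emeasure (density lborel ?W) (chart_map c ` F) =
        (\<integral>\<^sup>+ x\<in>chart_map c ` F. ?W x \<partial>lborel)"
        using borel_chart_image[OF M A c F] by (intro emeasure_density W) auto
      also have "\<dots> = \<nu> c F"
        unfolding \<nu>_def using F(2) by (intro nn_integral_cong) (auto simp: indicator_def)
      finally show ?thesis ..
    qed
    have "disjoint_family (\<lambda>n. chart_map c ` E n)"
      using E(2,3) smooth_atlasD(4)[OF A c] unfolding disjoint_family_on_def
      by (metis image_empty inj_on_image_Int)
    then have "(\<Sum>n. \<nu> c (E n)) = emeasure (density lborel ?W) (\<Union>n. chart_map c ` E n)"
      using borel_chart_image[OF M A c] E \<nu> by (subst suminf_emeasure[symmetric]) auto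
    also have "(\<Union>n. chart_map c ` E n) = chart_map c ` (\<Union>n. E n)" by auto
    also have "emeasure (density lborel ?W) \<dots> = \<nu> c (\<Union>n. E n)"
      using E by (intro \<nu>[symmetric]) auto
    finally show ?thesis .
  qed
  have \<nu>_overlap: "\<nu> d E = \<nu> c E"
    if "c \<in> A" "d \<in> A" "E \<in> sets ?R" "E \<subseteq> chart_dom c" "E \<subseteq> chart_dom d" for c d E
    unfolding \<nu>_def by (rule volume_density_overlap[OF M A g that])
  obtain c D where cD: "\<And>i::nat. c i \<in> A" "\<And>i. D i \<in> sets ?R"
    "\<And>i. D i \<subseteq> chart_dom (c i)" "disjoint_family D" "(\<Union>i. D i) = M"
    using countable_disjoint_chart_cover[OF M A False] by metis
  have sub: "E \<subseteq> M" if "E \<in> sets ?R" for E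
    using sets.sets_into_space[OF that] by (simp add: space_restrict_space)
  define m where "m E = (\<Sum>i. \<nu> (c i) (E \<inter> D i))" for E
  define \<mu> where "\<mu> = measure_of M (sets ?R) m"
  have sets_\<mu>: "sets \<mu> = sets ?R"
    unfolding \<mu>_def using sub sets.sigma_sets_eq[of ?R]
    by (subst sets_measure_of) (auto simp: space_restrict_space)
  have em: "emeasure \<mu> E = m E" if "E \<in> sets \<mu>" for E
  proof (rule emeasure_measure_of[OF \<mu>_def _ _ _ that])
    show "sets ?R \<subseteq> Pow M" using sub by auto
    show "positive (sets \<mu>) m" by (simp add: positive_def m_def \<nu>_def)
    show "countably_additive (sets \<mu>) m"
    proof (rule countably_additiveI)
      fix E :: "nat \<Rightarrow> 'a set"
      assume E: "range E \<subseteq> sets \<mu>" "disjoint_family E"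
      have "(\<Sum>n. m (E n)) = (\<Sum>i. \<Sum>n. \<nu> (c i) (E n \<inter> D i))"
        unfolding m_def by (rule suminf_swap_ennreal)
      also have "\<dots> = (\<Sum>i. \<nu> (c i) (\<Union>n. E n \<inter> D i))"
      proof (intro suminf_cong \<nu>_add cD(1))
        show "E n \<inter> D i \<in> sets ?R" for n i using E(1) cD(2) sets_\<mu> by blast
        show "E n \<inter> D i \<subseteq> chart_dom (c i)" for n i using cD(3) by blast
        show "disjoint_family (\<lambda>n. E n \<inter> D i)" for i
          using E(2) by (auto simp: disjoint_family_on_def)
      qed
      finally show "(\<Sum>n. m (E n)) = m (\<Union>n. E n)" by (simp add: m_def)
    qed
  qed
  have split: "(\<Union>i. E \<inter> D i) = E" if "E \<in> sets ?R" for E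
    using sub[OF that] cD(5) by auto
  have "is_riemannian_volume M A g \<mu>"
    unfolding is_riemannian_volume_def
  proof (intro conjI ballI impI)
    fix d B assume d: "d \<in> A" and B: "B \<in> sets \<mu>" "B \<subseteq> chart_dom d"
    have BR: "B \<in> sets ?R" and BD: "\<And>i. B \<inter> D i \<in> sets ?R"
      using B cD(2) sets_\<mu> by auto
    have "emeasure \<mu> B = (\<Sum>i. \<nu> (c i) (B \<inter> D i))" using em B by (simp add: m_def)
    also have "\<dots> = (\<Sum>i. \<nu> d (B \<inter> D i))"
      using B(2) cD(3) by (intro suminf_cong \<nu>_overlap d cD(1) BD) blast+
    also have "\<dots> = \<nu> d (\<Union>i. B \<inter> D i)"
      using B(2) cD(4) by (intro \<nu>_add d BD) (auto simp: disjoint_family_on_def)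
    finally show "emeasure \<mu> B = (\<integral>\<^sup>+ x\<in>chart_map d ` B.
      ennreal (sqrt (det (g d (chart_inv d x)))) \<partial>lborel)" by (simp only: \<nu>_def split[OF BR])
  qed (rule sets_\<mu>)
  moreover have "\<mu>' = \<mu>''"
    if v: "is_riemannian_volume M A g \<mu>'" "is_riemannian_volume M A g \<mu>''" for \<mu>' \<mu>''
  proof (rule measure_eqI)
    have s: "sets \<mu>' = sets ?R" "sets \<mu>'' = sets ?R"
      using v by (auto simp: is_riemannian_volume_def)
    then show "sets \<mu>' = sets \<mu>''" by simp
    fix E assume "E \<in> sets \<mu>'"
    then have E: "E \<in> sets ?R" using s by simp
    then have ED: "E \<inter> D i \<in> sets ?R" for i using cD(2) by auto
    have loc: "emeasure \<mu>' (E \<inter> D i) = emeasure \<mu>'' (E \<inter> D i)" for i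
    proof -
      have "E \<inter> D i \<subseteq> chart_dom (c i)" using cD(3) by auto
      then have "emeasure \<kappa> (E \<inter> D i) = \<nu> (c i) (E \<inter> D i)" if "is_riemannian_volume M A g \<kappa>" for \<kappa>
        using that ED cD(1) unfolding is_riemannian_volume_def \<nu>_def by simp
      then show ?thesis using v by simp
    qed
    have dj: "disjoint_family (\<lambda>i. E \<inter> D i)"
      using cD(4) unfolding disjoint_family_on_def by blast
    have "(\<Sum>i. emeasure \<kappa> (E \<inter> D i)) = emeasure \<kappa> E" if "sets \<kappa> = sets ?R" for \<kappa> :: "'a measure"
    proof -
      have "(\<Sum>i. emeasure \<kappa> (E \<inter> D i)) = emeasure \<kappa> (\<Union>i. E \<inter> D i)"
        using that ED by (intro suminf_emeasure dj) auto
      then show ?thesis by (simp only: split[OF E])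
    qed
    from this[OF s(1)] this[OF s(2)] show "emeasure \<mu>' E = emeasure \<mu>'' E"
      by (simp only: loc)
  qed
  ultimately show ?thesis by blast
qed

corollary riemannian_volume:
  "compact M \<Longrightarrow> smooth_atlas M A \<Longrightarrow> riemannian_metric A g \<Longrightarrow>
    is_riemannian_volume M A g (riemannian_volume M A g)"
  unfolding riemannian_volume_def by (rule theI'[OF ex1_riemannian_volume])

end

theory Submission
  imports Defs
begin

text \<open>Move \<open>\<psi>\<close> along the conformal fields of the sphere: for a unit vector \<open>a\<close> put
  \<open>\<psi>\<^sub>t = (\<psi> + t a) / \<bar>\<psi> + t a\<bar>\<close>.  With \<open>f = \<langle>\<psi>, a\<rangle>\<close>, \<open>e = \<bar>d\<psi>\<bar>\<^sup>2\<close>, \<open>q = \<bar>df\<bar>\<^sup>2\<close> and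
  \<open>N = 1 + 2 t f + t\<^sup>2\<close> one has \<open>\<bar>d\<psi>\<^sub>t\<bar>\<^sup>2 = e / N - t\<^sup>2 q / N\<^sup>2\<close>, so the second variation is an explicit
  integral.  Summing over an orthonormal basis of vectors \<open>a\<close>, where the \<open>f\<^sup>2\<close> add up to 1 and the \<open>q\<close>
  to \<open>e\<close>, gives the integral of
  \<open>2 \<alpha> (1 + e) powr (\<alpha> - 2) * e * ((2 \<alpha> - n) e - (n - 2))\<close>, which is negative; hence so is one of
  the summands.  Since \<open>e\<close> is nonnegative, the hypothesis forces \<open>2 \<alpha> > n > 2\<close>.\<close>

section \<open>Smooth maps\<close>

text \<open>The velocity of the family at t = 0 is a - f \<psi>, the gradient along \<psi> of the
  height function x -> <x, a>. This is how the conformal fields enter; the family itself is not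
  their flow. Since \<open>stable\<close> constrains every variation with a given field, the family
  can be chosen for convenience: the energy density of normalised translates is a rational function
  of t raised to the power \<alpha>, so no connection, curvature or general second variation formula
  is needed. With t + s in place of t the mixed derivative becomes an ordinary second derivative.
  For a single a the resulting integrand has no definite sign, which is why a sum over a basis is
  taken. Two analytic points remain: differentiating twice under the integral requires bounds
  uniform over M, and strict negativity of the final integral requires that nonempty open sets have
  positive volume.\<close>

lemma C_k_on_Suc_has_derivative:
  "C_k_on (Suc k) S f \<Longrightarrow> x \<in> S \<Longrightarrow> (f has_derivative frechet_derivative f (at x)) (at x)"
  by (simp add: frechet_derivative_works[symmetric])

text \<open>Openness of \<open>S\<close> is what matters: \<open>frechet_derivative\<close> at a
  point of \<open>S\<close> also sees values off \<open>S\<close>, and agreement on \<open>S\<close>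
  determines it because \<open>S\<close> is a neighbourhood of the point.\<close>

lemma C_k_on_cong:
  assumes "open S" "\<And>x. x \<in> S \<Longrightarrow> f x = g x" "C_k_on k S f"
  shows "C_k_on k S g"
  using assms(2,3)
proof (induction k arbitrary: f g)
  case 0
  then show ?case by (metis C_k_on.simps(1) continuous_on_cong)
next
  case (Suc k)
  have der: "(g has_derivative frechet_derivative f (at x)) (at x)" if "x \<in> S" for x
    using C_k_on_Suc_has_derivative[OF Suc.prems(2) that] assms(1) that Suc.prems(1)
    by (rule has_derivative_transform_within_open)
  then have eq: "frechet_derivative g (at x) = frechet_derivative f (at x)" if "x \<in> S" for x
    using that by (metis frechet_derivative_at)
  have "C_k_on k S (\<lambda>x. frechet_derivative g (at x) v)" for v
    using Suc.prems(2) eq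
    by (intro Suc.IH[of "\<lambda>x. frechet_derivative f (at x) v" "\<lambda>x. frechet_derivative g (at x) v"])
      simp_all
  moreover have "g differentiable (at x)" if "x \<in> S" for x
    using der[OF that] by (rule differentiableI)
  ultimately show ?case by simp
qed

text \<open>\<open>frechet_derivative\<close> is a choice operator; this rule replaces it by an
  explicit formula for the derivative, which is then treated one order lower.\<close>

lemma C_k_on_SucI:
  assumes S: "open S" and der: "\<And>x. x \<in> S \<Longrightarrow> (f has_derivative f' x) (at x)"
    and C: "\<And>v. C_k_on k S (\<lambda>x. f' x v)"
  shows "C_k_on (Suc k) S f"
proof -
  have "f' x = frechet_derivative f (at x)" if "x \<in> S" for x
    using der[OF that] by (rule frechet_derivative_at)
  then have "C_k_on k S (\<lambda>x. frechet_derivative f (at x) v)" for v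
    by (intro C_k_on_cong[OF S _ C]) simp
  moreover have "f differentiable (at x)" if "x \<in> S" for x
    using der[OF that] by (rule differentiableI)
  ultimately show ?thesis by simp
qed

text \<open>In the product and power rules some factors stay undifferentiated and have to be brought
  down from order k + 1 to order k.\<close>

lemma C_k_on_Suc_imp: "C_k_on (Suc k) S f \<Longrightarrow> C_k_on k S f"
proof (induction k arbitrary: f)
  case 0
  then show ?case
    by (simp add: differentiable_imp_continuous_on differentiable_on_def differentiable_at_withinI)
next
  case (Suc k)
  have "f differentiable (at x)" if "x \<in> S" for x using Suc.prems that by simp
  moreover have "C_k_on k S (\<lambda>x. frechet_derivative f (at x) v)" for v
    using Suc.prems by (intro Suc.IH) simp
  ultimately show ?case by simp
qed

lemma C_k_on_const: "open S \<Longrightarrow> C_k_on k S (\<lambda>x. c)"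
  by (induction k arbitrary: c) (auto intro!: C_k_on_SucI[where f' = "\<lambda>x v. 0"])

lemma C_k_on_add:
  assumes "open S"
  shows "C_k_on k S f \<Longrightarrow> C_k_on k S g \<Longrightarrow> C_k_on k S (\<lambda>x. f x + g x)"
proof (induction k arbitrary: f g)
  case 0
  then show ?case by (simp add: continuous_on_add)
next
  case (Suc k)
  show ?case
  proof (rule C_k_on_SucI[OF assms])
    show "((\<lambda>x. f x + g x) has_derivative
      (\<lambda>v. frechet_derivative f (at x) v + frechet_derivative g (at x) v)) (at x)" if "x \<in> S" for x
      by (intro has_derivative_add C_k_on_Suc_has_derivative[OF Suc.prems(1) that]
          C_k_on_Suc_has_derivative[OF Suc.prems(2) that])
  qed (use Suc in auto)
qed

text \<open>The product rule yields two terms of the same bilinear shape, so the induction closes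
  with \<open>f\<close> and \<open>g\<close> varying. One proof serves scaling, inner products and
  products of reals.\<close>

lemma C_k_on_bilinear:
  assumes "open S" and bil: "bounded_bilinear pr"
  shows "C_k_on k S f \<Longrightarrow> C_k_on k S g \<Longrightarrow> C_k_on k S (\<lambda>x. pr (f x) (g x))"
proof (induction k arbitrary: f g)
  case 0
  then show ?case using bounded_bilinear.continuous_on[OF bil] by simp
next
  case (Suc k)
  show ?case
  proof (rule C_k_on_SucI[OF assms(1)])
    show "((\<lambda>x. pr (f x) (g x)) has_derivative
      (\<lambda>v. pr (f x) (frechet_derivative g (at x) v) + pr (frechet_derivative f (at x) v) (g x))) (at x)"
      if "x \<in> S" for x
      by (intro bounded_bilinear.FDERIV[OF bil] C_k_on_Suc_has_derivative[OF Suc.prems(1) that]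
          C_k_on_Suc_has_derivative[OF Suc.prems(2) that])
    show "C_k_on k S (\<lambda>x. pr (f x) (frechet_derivative g (at x) v)
        + pr (frechet_derivative f (at x) v) (g x))" for v
      using Suc.prems C_k_on_Suc_imp[OF Suc.prems(1)] C_k_on_Suc_imp[OF Suc.prems(2)]
      by (intro C_k_on_add[OF assms(1)] Suc.IH) simp_all
  qed
qed

text \<open>A linear inner map has constant derivative \<open>L\<close>, so differentiation keeps
  the shape of the composition and no higher chain rule arises. It is applied to projections, to
  read a map of x as a map of (t, s, x).\<close>

lemma C_k_on_compose_linear:
  assumes "open S" "bounded_linear L" "\<And>x. x \<in> S \<Longrightarrow> L x \<in> T"
  shows "C_k_on k T f \<Longrightarrow> C_k_on k S (\<lambda>x. f (L x))"
proof (induction k arbitrary: f)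
  case 0
  then show ?case
    using continuous_on_compose2[of T f S L] linear_continuous_on[OF assms(2)] assms(3) by auto
next
  case (Suc k)
  show ?case
  proof (rule C_k_on_SucI[OF assms(1)])
    show "((\<lambda>x. f (L x)) has_derivative (\<lambda>v. frechet_derivative f (at (L x)) (L v))) (at x)"
      if "x \<in> S" for x
      using C_k_on_Suc_has_derivative[OF Suc.prems] assms(3)[OF that]
        bounded_linear_imp_has_derivative[OF assms(2)]
      by (intro has_derivative_compose[of L L _ _ f]) auto
  qed (use Suc in auto)
qed

lemma C_k_on_linear:
  assumes "open S" "bounded_linear L"
  shows "C_k_on k S L"
proof (cases k)
  case 0
  then show ?thesis using linear_continuous_on[OF assms(2)] by simp
next
  case (Suc k')
  show ?thesis unfolding Suc
    by (rule C_k_on_SucI[where f' = "\<lambda>x. L"])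
      (use assms bounded_linear_imp_has_derivative in \<open>auto intro: C_k_on_const\<close>)
qed

text \<open>The derivative brings in the same function with exponent r - 1, hence the induction over
  all exponents at once.\<close>

lemma C_k_on_powr:
  fixes f :: "'a::real_normed_vector \<Rightarrow> real"
  assumes "open S" "\<And>x. x \<in> S \<Longrightarrow> f x > 0"
  shows "C_k_on k S f \<Longrightarrow> C_k_on k S (\<lambda>x. f x powr r)"
proof (induction k arbitrary: r)
  case 0
  then show ?case using assms(2) by (auto intro!: continuous_on_powr simp: less_imp_neq[THEN not_sym])
next
  case (Suc k)
  show ?case
  proof (rule C_k_on_SucI[OF assms(1)])
    show "((\<lambda>x. f x powr r) has_derivative
      (\<lambda>v. (r * f x powr (r - 1)) * frechet_derivative f (at x) v)) (at x)" if "x \<in> S" for x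
    proof -
      have "((\<lambda>y. y powr r) has_derivative (*) (r * f x powr (r - 1))) (at (f x))"
        using has_real_derivative_powr[OF assms(2)[OF that], of r]
        by (simp add: has_field_derivative_def)
      then show ?thesis
        using has_derivative_compose[OF C_k_on_Suc_has_derivative[OF Suc.prems that]] by blast
    qed
    show "C_k_on k S (\<lambda>x. r * f x powr (r - 1) * frechet_derivative f (at x) v)" for v
      using Suc.prems C_k_on_Suc_imp[OF Suc.prems]
      by (intro C_k_on_bilinear[OF assms(1) bounded_bilinear_mult]
          C_k_on_const[OF assms(1)] Suc.IH) simp_all
  qed
qed

lemma smooth_on_const: "open S \<Longrightarrow> smooth_on S (\<lambda>x. c)"
  by (simp add: smooth_on_def C_k_on_const)

lemma smooth_on_linear: "open S \<Longrightarrow> bounded_linear L \<Longrightarrow> smooth_on S L"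
  by (simp add: smooth_on_def C_k_on_linear)

lemma smooth_on_add:
  "open S \<Longrightarrow> smooth_on S f \<Longrightarrow> smooth_on S g \<Longrightarrow> smooth_on S (\<lambda>x. f x + g x)"
  by (simp add: smooth_on_def C_k_on_add)

lemma smooth_on_inner:
  fixes f g :: "'a::real_normed_vector \<Rightarrow> 'b::euclidean_space"
  shows "open S \<Longrightarrow> smooth_on S f \<Longrightarrow> smooth_on S g \<Longrightarrow> smooth_on S (\<lambda>x. f x \<bullet> g x)"
  by (simp add: smooth_on_def C_k_on_bilinear[OF _ bounded_bilinear_inner])

lemma smooth_on_scaleR:
  "open S \<Longrightarrow> smooth_on S f \<Longrightarrow> smooth_on S g \<Longrightarrow> smooth_on S (\<lambda>x. f x *\<^sub>R g x)"
  by (simp add: smooth_on_def C_k_on_bilinear[OF _ bounded_bilinear_scaleR])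

lemma smooth_on_compose_linear:
  "open S \<Longrightarrow> bounded_linear L \<Longrightarrow> (\<And>x. x \<in> S \<Longrightarrow> L x \<in> T) \<Longrightarrow> smooth_on T f \<Longrightarrow>
    smooth_on S (\<lambda>x. f (L x))"
  unfolding smooth_on_def by (blast intro: C_k_on_compose_linear)

text \<open>Normalisation is multiplication by the power -1/2 of the squared norm, which is smooth
  where the map does not vanish.\<close>

lemma smooth_on_sgn:
  fixes f :: "'a::real_normed_vector \<Rightarrow> 'b::euclidean_space"
  assumes "open S" "smooth_on S f" "\<And>x. x \<in> S \<Longrightarrow> f x \<noteq> 0"
  shows "smooth_on S (\<lambda>x. sgn (f x))"
proof -
  have "smooth_on S (\<lambda>x. (f x \<bullet> f x) powr (- (1/2)))"
    using smooth_on_inner[OF assms(1,2,2)] assms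
    by (simp add: smooth_on_def C_k_on_powr)
  then have "smooth_on S (\<lambda>x. (f x \<bullet> f x) powr (- (1/2)) *\<^sub>R f x)"
    by (intro smooth_on_scaleR assms)
  moreover have "(f x \<bullet> f x) powr (- (1/2)) *\<^sub>R f x = sgn (f x)" for x
    by (simp add: sgn_div_norm powr_minus powr_half_sqrt norm_eq_sqrt_inner)
  ultimately show ?thesis by simp
qed

section \<open>Positive definite matrices\<close>

text \<open>\<open>matrix_inv\<close> is a choice operator; it is pinned down because a one-sided
  inverse of a square matrix is two-sided.\<close>

lemma matrix_inv_unique:
  fixes A B :: "real ^ 'n ^ 'n"
  assumes "A ** B = mat 1"
  shows "matrix_inv A = B"
proof -
  have "\<exists>C. A ** C = mat 1 \<and> C ** A = mat 1"
    using assms matrix_left_right_inverse by blast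
  then have "matrix_inv A ** A = mat 1"
    unfolding matrix_inv_def by (rule someI2_ex) simp
  then show ?thesis
    by (metis assms matrix_mul_assoc matrix_mul_lid matrix_mul_rid)
qed

lemma matrix_inv_right:
  fixes A :: "real ^ 'n ^ 'n"
  assumes "det A \<noteq> 0"
  shows "A ** matrix_inv A = mat 1"
  using assms matrix_inv_unique unfolding invertible_det_nz[symmetric] invertible_def by metis

text \<open>Cramer's rule for A x = e_j, whose solution is column j of the inverse. The quotient of
  determinants shows that the entries depend continuously on \<open>A\<close>.\<close>

lemma matrix_inv_nth:
  fixes A :: "real ^ 'n ^ 'n"
  assumes "det A \<noteq> 0"
  shows "matrix_inv A $ i $ j =
    det (\<chi> k l. if l = i then axis j 1 $ k else A $ k $ l) / det A"
proof -
  have "A *v (matrix_inv A *v axis j 1) = axis j 1"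
    by (simp add: matrix_vector_mul_assoc matrix_inv_right[OF assms])
  then have "matrix_inv A *v axis j 1 =
      (\<chi> i. det (\<chi> k l. if l = i then axis j 1 $ k else A $ k $ l) / det A)"
    by (simp add: cramer[OF assms])
  then have "(matrix_inv A *v axis j 1) $ i =
      det (\<chi> k l. if l = i then axis j 1 $ k else A $ k $ l) / det A" by simp
  then show ?thesis by (simp add: matrix_vector_mul_component inner_axis)
qed

lemma continuous_on_matrix_inv_nth:
  fixes f :: "'x::topological_space \<Rightarrow> real ^ 'n ^ 'n"
  assumes f: "continuous_on S f" and nz: "\<And>x. x \<in> S \<Longrightarrow> det (f x) \<noteq> 0"
  shows "continuous_on S (\<lambda>x. matrix_inv (f x) $ i $ j)"
proof -
  have "continuous_on S (\<lambda>x. det (\<chi> k l. if l = i then axis j 1 $ k else f x $ k $ l) / det (f x))"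
  proof (intro continuous_on_divide continuous_on_matrix_det f continuous_on_vec_lambda)
    fix k l
    show "continuous_on S (\<lambda>x. if l = i then axis j 1 $ k else f x $ k $ l)"
      by (cases "l = i") (auto intro!: continuous_on_component f)
  qed (use nz in auto)
  then show ?thesis
    by (rule continuous_on_eq) (simp add: matrix_inv_nth nz)
qed

text \<open>The segment from the identity to \<open>G\<close> consists of invertible matrices.\<close>

lemma det_pos_definite:
  fixes G :: "real ^ 'n ^ 'n"
  assumes pd: "\<And>v. v \<noteq> 0 \<Longrightarrow> v \<bullet> (G *v v) > 0"
  shows "det G > 0"
proof (rule ccontr)
  assume neg: "\<not> det G > 0"
  let ?h = "\<lambda>t. (1 - t) *\<^sub>R mat 1 + t *\<^sub>R G"
  have nz: "det (?h t) \<noteq> 0" if t: "0 \<le> t" "t \<le> 1" for t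
  proof
    assume "det (?h t) = 0"
    then obtain v where v: "v \<noteq> 0" "?h t *v v = 0"
      by (metis invertible_det_nz invertible_left_inverse matrix_left_invertible_ker)
    have "0 = v \<bullet> (?h t *v v)" using v by simp
    also have "\<dots> = (1 - t) * (v \<bullet> v) + t * (v \<bullet> (G *v v))"
      by (simp add: matrix_vector_mult_add_rdistrib scaleR_matrix_vector_assoc[symmetric]
          inner_add_right)
    also have "\<dots> > 0"
      using t v(1) pd[OF v(1)]
      by (cases "t = 0") (auto intro!: add_nonneg_pos mult_nonneg_nonneg mult_pos_pos)
    finally show False by simp
  qed
  have "\<exists>t\<ge>0. t \<le> 1 \<and> det (?h t) = 0"
    by (rule IVT2') (use neg in \<open>auto intro!: continuous_on_matrix_det continuous_intros\<close>)
  with nz show False by blast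
qed

text \<open>Let v collect the components of the \<open>P i\<close> along one basis vector and put w
  = G^-1 v. Then v . G^-1 v = w . G w, which is nonnegative; summing over the basis of the target
  recovers the inner products.\<close>

lemma matrix_inv_form_nonneg:
  fixes G :: "real ^ 'n ^ 'n" and P :: "'n \<Rightarrow> 'b::euclidean_space"
  assumes pd: "\<And>v. v \<noteq> 0 \<Longrightarrow> v \<bullet> (G *v v) > 0"
  shows "0 \<le> (\<Sum>i\<in>UNIV. \<Sum>j\<in>UNIV. matrix_inv G $ i $ j * (P i \<bullet> P j))"
proof -
  let ?H = "matrix_inv G"
  have "0 \<le> (\<Sum>i\<in>UNIV. \<Sum>j\<in>UNIV. ?H $ i $ j * ((P i \<bullet> b) * (P j \<bullet> b)))" for b
  proof -
    define v where "v = (\<chi> i. P i \<bullet> b)"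
    let ?w = "?H *v v"
    have "v = G *v ?w"
      using matrix_inv_right[of G] det_pos_definite[OF pd]
      by (simp add: matrix_vector_mul_assoc)
    then have "v \<bullet> ?w = ?w \<bullet> (G *v ?w)" by (metis inner_commute)
    also have "\<dots> \<ge> 0" using pd[of ?w] by (cases "?w = 0") auto
    finally have "0 \<le> v \<bullet> ?w" .
    also have "v \<bullet> ?w = (\<Sum>i\<in>UNIV. \<Sum>j\<in>UNIV. ?H $ i $ j * ((P i \<bullet> b) * (P j \<bullet> b)))"
      unfolding inner_vec_def matrix_vector_mult_def
      by (simp add: v_def sum_distrib_left mult_ac)
    finally show ?thesis .
  qed
  then have "0 \<le> (\<Sum>b\<in>Basis. \<Sum>i\<in>UNIV. \<Sum>j\<in>UNIV. ?H $ i $ j * ((P i \<bullet> b) * (P j \<bullet> b)))"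
    by (rule sum_nonneg)
  also have "\<dots> = (\<Sum>i\<in>UNIV. \<Sum>j\<in>UNIV. \<Sum>b\<in>Basis. ?H $ i $ j * ((P i \<bullet> b) * (P j \<bullet> b)))"
    by (subst sum.swap) (intro sum.cong refl sum.swap)
  also have "\<dots> = (\<Sum>i\<in>UNIV. \<Sum>j\<in>UNIV. ?H $ i $ j * (P i \<bullet> P j))"
    unfolding sum_distrib_left[symmetric] by (simp add: euclidean_inner[symmetric])
  finally show ?thesis .
qed

text \<open>With K the inverse of J^T G J one has G^-1 = J K J^T, which exactly absorbs the passage
  from \<open>Q\<close> to \<open>P\<close>. This is the invariance of g^{ij} <d_i u, d_j u> under a
  change of frame.\<close>

lemma matrix_inv_form_congruence:
  fixes G J :: "real ^ 'n ^ 'n" and P Q :: "'n \<Rightarrow> 'b::euclidean_space"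
  assumes det: "det (transpose J ** G ** J) \<noteq> 0"
    and P: "\<And>i. P i = (\<Sum>k\<in>UNIV. J $ k $ i *\<^sub>R Q k)"
  shows "(\<Sum>i\<in>UNIV. \<Sum>j\<in>UNIV. matrix_inv (transpose J ** G ** J) $ i $ j * (P i \<bullet> P j)) =
    (\<Sum>k\<in>UNIV. \<Sum>l\<in>UNIV. matrix_inv G $ k $ l * (Q k \<bullet> Q l))"
proof -
  let ?K = "matrix_inv (transpose J ** G ** J)"
  have dJ: "det J \<noteq> 0" and dG: "det G \<noteq> 0" using det by (auto simp: det_mul)
  then obtain L where L: "J ** L = mat 1" "L ** J = mat 1"
    by (metis invertible_det_nz invertible_def)
  have tL: "transpose L ** transpose J = mat 1"
    using L(1) by (metis matrix_transpose_mul transpose_mat)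
  have "transpose L ** ((transpose J ** G ** J) ** ?K) = transpose L"
    using matrix_inv_right[OF det] by simp
  then have "(transpose L ** transpose J) ** (G ** (J ** ?K)) = transpose L"
    by (simp add: matrix_mul_assoc)
  then have "G ** (J ** ?K) = transpose L" by (simp add: tL)
  then have "G ** (J ** ?K ** transpose J) = mat 1"
    by (metis matrix_mul_assoc tL)
  then have inv: "matrix_inv G = J ** ?K ** transpose J" by (rule matrix_inv_unique)
  have nth: "matrix_inv G $ k $ l = (\<Sum>i\<in>UNIV. \<Sum>j\<in>UNIV. ?K $ i $ j * J $ k $ i * J $ l $ j)" for k l
    unfolding inv matrix_matrix_mult_def transpose_def
    by (subst sum.swap) (simp add: sum_distrib_right sum_distrib_left mult_ac)
  have "(\<Sum>i\<in>UNIV. \<Sum>j\<in>UNIV. ?K $ i $ j * (P i \<bullet> P j)) =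
    (\<Sum>i\<in>UNIV. \<Sum>j\<in>UNIV. \<Sum>k\<in>UNIV. \<Sum>l\<in>UNIV. ?K $ i $ j * J $ k $ i * J $ l $ j * (Q k \<bullet> Q l))"
    unfolding P inner_sum_left
    by (simp add: inner_sum_right sum_distrib_left mult_ac)
  also have "\<dots> = (\<Sum>i\<in>UNIV. \<Sum>k\<in>UNIV. \<Sum>l\<in>UNIV. \<Sum>j\<in>UNIV. ?K $ i $ j * J $ k $ i * J $ l $ j * (Q k \<bullet> Q l))"
    by (subst sum.swap) (intro sum.cong refl sum.swap)
  also have "\<dots> = (\<Sum>k\<in>UNIV. \<Sum>l\<in>UNIV. \<Sum>i\<in>UNIV. \<Sum>j\<in>UNIV. ?K $ i $ j * J $ k $ i * J $ l $ j * (Q k \<bullet> Q l))"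
    by (subst sum.swap) (intro sum.cong refl sum.swap)
  also have "\<dots> = (\<Sum>k\<in>UNIV. \<Sum>l\<in>UNIV. matrix_inv G $ k $ l * (Q k \<bullet> Q l))"
    unfolding nth by (simp add: sum_distrib_right)
  finally show ?thesis .
qed

lemma riemannian_metric_pos_definite:
  "riemannian_metric A g \<Longrightarrow> c \<in> A \<Longrightarrow> p \<in> chart_dom c \<Longrightarrow> v \<noteq> 0 \<Longrightarrow> v \<bullet> (g c p *v v) > 0"
  unfolding riemannian_metric_def by blast

lemma riemannian_metric_det_pos:
  "riemannian_metric A g \<Longrightarrow> c \<in> A \<Longrightarrow> p \<in> chart_dom c \<Longrightarrow> det (g c p) > 0"
  by (intro det_pos_definite riemannian_metric_pos_definite)

text \<open>Serves twice: the chart image of an overlap is a neighbourhood on which two coordinate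
  expressions can be compared, and the chart image of a nonempty open set cannot be null.\<close>

lemma open_chart_image:
  assumes A: "smooth_atlas M A" and c: "c \<in> A" and U: "openin (top_of_set M) U" "U \<subseteq> chart_dom c"
  shows "open (chart_map c ` U)"
proof -
  note D = smooth_atlasD[OF A c]
  obtain T where T: "open T" "U = M \<inter> T" using U(1) by (auto simp: openin_open)
  have "chart_map c ` U = chart_ran c \<inter> chart_inv c -` T"
    using D(1,7-9) T(2) U(2) by (auto simp: image_iff subset_iff)
  then show ?thesis using continuous_open_preimage[OF D(6,3) T(1)] by simp
qed

section \<open>The norm of the differential\<close>

text \<open>Smoothness with no condition on the values, so that it covers both \<psi> and its real
  components.\<close>

definition smooth_in_charts ::
  "('a, 'm::{finite, wellorder}) chart set \<Rightarrow> ('a \<Rightarrow> 'b::real_normed_vector) \<Rightarrow> bool" where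
  "smooth_in_charts A u \<longleftrightarrow> (\<forall>c\<in>A. smooth_on (chart_ran c) (u \<circ> chart_inv c))"

lemma smooth_in_charts_has_derivative:
  assumes "smooth_atlas M A" "smooth_in_charts A u" "c \<in> A" "p \<in> chart_dom c"
  shows "(u \<circ> chart_inv c has_derivative
    frechet_derivative (u \<circ> chart_inv c) (at (chart_map c p))) (at (chart_map c p))"
proof -
  have "smooth_on (chart_ran c) (u \<circ> chart_inv c)"
    using assms(2,3) by (simp add: smooth_in_charts_def)
  then show ?thesis
    using smooth_on_imp_differentiable assms(4) frechet_derivative_works by blast
qed

lemma smooth_in_charts_inner_const:
  fixes u :: "'a::t2_space \<Rightarrow> 'b::euclidean_space"
  assumes "smooth_atlas M A" "smooth_in_charts A u"
  shows "smooth_in_charts A (\<lambda>p. u p \<bullet> a)"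
  unfolding smooth_in_charts_def
proof
  fix c assume c: "c \<in> A"
  have "smooth_on (chart_ran c) (u \<circ> chart_inv c)"
    using assms(2) c by (simp add: smooth_in_charts_def)
  then have "smooth_on (chart_ran c) (\<lambda>x. (u \<circ> chart_inv c) x \<bullet> a)"
    by (intro smooth_on_inner smooth_on_const smooth_atlasD(3)[OF assms(1) c])
  then show "smooth_on (chart_ran c) ((\<lambda>p. u p \<bullet> a) \<circ> chart_inv c)" by (simp add: o_def)
qed

lemma continuous_on_charts:
  assumes A: "smooth_atlas M A" and h: "\<And>c. c \<in> A \<Longrightarrow> continuous_on (chart_dom c) h"
  shows "continuous_on M h"
  unfolding continuous_on_eq_continuous_within
proof
  fix p assume p: "p \<in> M"
  then obtain c where c: "c \<in> A" "p \<in> chart_dom c" using A by (auto simp: smooth_atlas_def)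
  obtain T where T: "open T" "chart_dom c = M \<inter> T"
    using smooth_atlasD(2)[OF A c(1)] by (auto simp: openin_open)
  have "at p within chart_dom c = at p within M"
    by (rule at_within_nhd[of _ T]) (use T c in auto)
  with h[OF c(1)] c(2) show "continuous (at p within M) h"
    by (metis continuous_on_eq_continuous_within)
qed

lemma smooth_in_charts_imp_continuous_on:
  assumes A: "smooth_atlas M A" and u: "smooth_in_charts A u"
  shows "continuous_on M u"
proof (rule continuous_on_charts[OF A])
  fix c assume c: "c \<in> A"
  note D = smooth_atlasD[OF A c]
  have su: "smooth_on (chart_ran c) (u \<circ> chart_inv c)"
    using u c by (simp add: smooth_in_charts_def)
  have "continuous_on (chart_dom c) (\<lambda>p. (u \<circ> chart_inv c) (chart_map c p))"
    by (rule continuous_on_compose2[OF smooth_on_imp_continuous_on[OF su] D(5)]) simp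
  then show "continuous_on (chart_dom c) u"
    by (rule continuous_on_eq) (simp add: D(7))
qed

lemma partial_deriv_change_chart:
  fixes u :: "'a::t2_space \<Rightarrow> 'b::euclidean_space"
  assumes A: "smooth_atlas M A" and c: "c \<in> A" "p \<in> chart_dom c" and d: "d \<in> A" "p \<in> chart_dom d"
    and u: "smooth_in_charts A u"
  shows "partial_deriv c u p i =
    (\<Sum>k\<in>UNIV. transition_jacobian c d p $ k $ i *\<^sub>R partial_deriv d u p k)"
proof -
  let ?T = "chart_map d \<circ> chart_inv c" and ?W = "chart_map c ` (chart_dom c \<inter> chart_dom d)"
  let ?x = "chart_map c p"
  note C = smooth_atlasD[OF A c(1)] and D = smooth_atlasD[OF A d(1)]
  have W: "open ?W" "?x \<in> ?W"
    using c d C(2) D(2) by (auto intro!: open_chart_image[OF A] openin_Int)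
  define F where "F = frechet_derivative ?T (at ?x)"
  define G where "G = frechet_derivative (u \<circ> chart_inv d) (at (chart_map d p))"
  have F: "(?T has_derivative F) (at ?x)"
  proof -
    have "smooth_on ?W ?T" using A c(1) d(1) by (auto simp: smooth_atlas_def)
    then show ?thesis
      unfolding F_def using smooth_on_imp_differentiable W(2) frechet_derivative_works by blast
  qed
  have G: "(u \<circ> chart_inv d has_derivative G) (at (?T ?x))"
    using smooth_in_charts_has_derivative[OF A u d] C(7)[OF c(2)] by (simp add: G_def)
  have "(u \<circ> chart_inv c has_derivative (\<lambda>v. G (F v))) (at ?x)"
  proof (rule has_derivative_transform_within_open[OF _ W])
    show "((\<lambda>x. (u \<circ> chart_inv d) (?T x)) has_derivative (\<lambda>v. G (F v))) (at ?x)"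
      by (rule has_derivative_compose[OF F G])
  qed (use C(7) D(7) in auto)
  then have "frechet_derivative (u \<circ> chart_inv c) (at ?x) = (\<lambda>v. G (F v))"
    by (rule frechet_derivative_at[symmetric])
  then have "partial_deriv c u p i = G (F (axis i 1))" by (simp add: partial_deriv_def)
  also have "F (axis i 1) = (\<Sum>k\<in>UNIV. F (axis i 1) $ k *\<^sub>R axis k 1)"
    using basis_expansion[of "F (axis i 1)"] by (simp add: scalar_mult_eq_scaleR)
  also have "G \<dots> = (\<Sum>k\<in>UNIV. F (axis i 1) $ k *\<^sub>R G (axis k 1))"
    using has_derivative_linear[OF G] by (simp add: linear_sum linear_cmul)
  finally show ?thesis
    by (simp add: F_def G_def transition_jacobian_def matrix_def partial_deriv_def)
qed

text \<open>The definition picks a chart by \<open>SOME\<close>, possibly a different one at every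
  point. Independence of the chart allows one chart to be kept on its whole domain, where continuity
  in \<open>p\<close> can be read off.\<close>

lemma norm_sq_differential_chart:
  fixes u :: "'a::t2_space \<Rightarrow> 'b::euclidean_space"
  assumes A: "smooth_atlas M A" and g: "riemannian_metric A g" and u: "smooth_in_charts A u"
    and c: "c \<in> A" "p \<in> chart_dom c"
  shows "norm_sq_differential A g u p = (\<Sum>i\<in>UNIV. \<Sum>j\<in>UNIV.
    matrix_inv (g c p) $ i $ j * (partial_deriv c u p i \<bullet> partial_deriv c u p j))"
proof -
  define d where "d = (SOME d. d \<in> A \<and> p \<in> chart_dom d)"
  have "\<exists>d. d \<in> A \<and> p \<in> chart_dom d" using c by blast
  then have d: "d \<in> A" "p \<in> chart_dom d" unfolding d_def by (metis (mono_tags, lifting) someI_ex)+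
  let ?J = "transition_jacobian d c p"
  have J: "g d p = transpose ?J ** g c p ** ?J"
    using g c d unfolding riemannian_metric_def by blast
  have "norm_sq_differential A g u p = (\<Sum>i\<in>UNIV. \<Sum>j\<in>UNIV.
    matrix_inv (g d p) $ i $ j * (partial_deriv d u p i \<bullet> partial_deriv d u p j))"
    by (simp add: norm_sq_differential_def d_def Let_def)
  also have "\<dots> = (\<Sum>i\<in>UNIV. \<Sum>j\<in>UNIV.
    matrix_inv (g c p) $ i $ j * (partial_deriv c u p i \<bullet> partial_deriv c u p j))"
    unfolding J
    by (intro matrix_inv_form_congruence partial_deriv_change_chart[OF A d c u])
      (use riemannian_metric_det_pos[OF g d] J in simp)
  finally show ?thesis .
qed

lemma continuous_on_norm_sq_differential:
  fixes u :: "'a::t2_space \<Rightarrow> 'b::euclidean_space"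
  assumes A: "smooth_atlas M A" and g: "riemannian_metric A g" and u: "smooth_in_charts A u"
  shows "continuous_on M (norm_sq_differential A g u)"
proof -
  have dom: "continuous_on (chart_dom c) (norm_sq_differential A g u)" if c: "c \<in> A" for c
  proof -
    note D = smooth_atlasD[OF A c]
    have sg: "smooth_on (chart_ran c) (g c \<circ> chart_inv c)"
      using g c by (simp add: riemannian_metric_def)
    have "continuous_on (chart_dom c) (\<lambda>p. (g c \<circ> chart_inv c) (chart_map c p))"
      by (rule continuous_on_compose2[OF smooth_on_imp_continuous_on[OF sg] D(5)]) simp
    then have gc: "continuous_on (chart_dom c) (g c)"
      by (rule continuous_on_eq) (simp add: D(7))
    have "C_k_on (Suc 0) (chart_ran c) (u \<circ> chart_inv c)"
      using u c unfolding smooth_in_charts_def smooth_on_def by blast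
    then have "continuous_on (chart_ran c) (\<lambda>x. frechet_derivative (u \<circ> chart_inv c) (at x) v)" for v
      by simp
    then have pc: "continuous_on (chart_dom c) (\<lambda>p. partial_deriv c u p i)" for i
      unfolding partial_deriv_def by (rule continuous_on_compose2[OF _ D(5)]) simp
    have "continuous_on (chart_dom c) (\<lambda>p. \<Sum>i\<in>UNIV. \<Sum>j\<in>UNIV.
      matrix_inv (g c p) $ i $ j * (partial_deriv c u p i \<bullet> partial_deriv c u p j))"
      by (intro continuous_on_sum continuous_on_mult continuous_on_inner pc
          continuous_on_matrix_inv_nth gc riemannian_metric_det_pos[OF g c, THEN less_imp_neq, THEN not_sym])
    then show ?thesis
      by (rule continuous_on_eq) (simp add: norm_sq_differential_chart[OF A g u c])
  qed
  then show ?thesis by (rule continuous_on_charts[OF A])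
qed

lemma norm_sq_differential_nonneg:
  fixes u :: "'a::t2_space \<Rightarrow> 'b::euclidean_space"
  assumes A: "smooth_atlas M A" and g: "riemannian_metric A g" and u: "smooth_in_charts A u"
    and p: "p \<in> M"
  shows "0 \<le> norm_sq_differential A g u p"
proof -
  obtain c where c: "c \<in> A" "p \<in> chart_dom c" using A p by (auto simp: smooth_atlas_def)
  show ?thesis
    unfolding norm_sq_differential_chart[OF A g u c]
    by (intro matrix_inv_form_nonneg riemannian_metric_pos_definite[OF g c])
qed

lemma partial_deriv_inner_const:
  fixes u :: "'a::t2_space \<Rightarrow> 'b::euclidean_space"
  assumes "smooth_atlas M A" "smooth_in_charts A u" "c \<in> A" "p \<in> chart_dom c"
  shows "partial_deriv c (\<lambda>p. u p \<bullet> a) p i = partial_deriv c u p i \<bullet> a"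
proof -
  have "((\<lambda>p. u p \<bullet> a) \<circ> chart_inv c has_derivative
    (\<lambda>v. frechet_derivative (u \<circ> chart_inv c) (at (chart_map c p)) v \<bullet> a)) (at (chart_map c p))"
    using has_derivative_inner_left[OF smooth_in_charts_has_derivative[OF assms]]
    by (simp add: o_def)
  from frechet_derivative_at[OF this] show ?thesis
    unfolding partial_deriv_def by (metis (no_types))
qed

text \<open>Parseval in the target, applied to <d_i u, d_j u>. All terms being nonnegative, it also
  bounds each component's term by the whole.\<close>

lemma norm_sq_differential_sum_Basis:
  fixes u :: "'a::t2_space \<Rightarrow> 'b::euclidean_space"
  assumes A: "smooth_atlas M A" and g: "riemannian_metric A g" and u: "smooth_in_charts A u"
    and p: "p \<in> M"
  shows "(\<Sum>b\<in>Basis. norm_sq_differential A g (\<lambda>p. u p \<bullet> b) p) = norm_sq_differential A g u p"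
proof -
  obtain c where c: "c \<in> A" "p \<in> chart_dom c" using A p by (auto simp: smooth_atlas_def)
  let ?H = "matrix_inv (g c p)" and ?P = "partial_deriv c u p"
  have "(\<Sum>b\<in>Basis. norm_sq_differential A g (\<lambda>p. u p \<bullet> b) p) =
    (\<Sum>b\<in>Basis. \<Sum>i\<in>UNIV. \<Sum>j\<in>UNIV. ?H $ i $ j * ((?P i \<bullet> b) * (?P j \<bullet> b)))"
    by (simp add: norm_sq_differential_chart[OF A g smooth_in_charts_inner_const[OF A u] c]
        partial_deriv_inner_const[OF A u c])
  also have "\<dots> = (\<Sum>i\<in>UNIV. \<Sum>j\<in>UNIV. \<Sum>b\<in>Basis. ?H $ i $ j * ((?P i \<bullet> b) * (?P j \<bullet> b)))"
    by (subst sum.swap) (intro sum.cong refl sum.swap)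
  also have "\<dots> = (\<Sum>i\<in>UNIV. \<Sum>j\<in>UNIV. ?H $ i $ j * (?P i \<bullet> ?P j))"
    unfolding sum_distrib_left[symmetric] by (simp add: euclidean_inner[symmetric])
  also have "\<dots> = norm_sq_differential A g u p"
    by (simp add: norm_sq_differential_chart[OF A g u c])
  finally show ?thesis .
qed

section \<open>Normalised translates of a sphere-valued map\<close>

lemma has_derivative_sgn:
  fixes f :: "'x::real_normed_vector \<Rightarrow> 'b::euclidean_space"
  assumes f: "(f has_derivative f') (at x)" and nz: "f x \<noteq> 0"
  shows "((\<lambda>x. sgn (f x)) has_derivative
    (\<lambda>v. f' v /\<^sub>R norm (f x) - (f x \<bullet> f' v / norm (f x) ^ 3) *\<^sub>R f x)) (at x)"
proof -
  have "((\<lambda>x. norm (f x)) has_derivative (\<lambda>v. sgn (f x) \<bullet> f' v)) (at x)"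
    using has_derivative_compose[OF f has_derivative_norm[OF nz]] by (simp add: inner_commute)
  from has_derivative_scaleR[OF Deriv.has_derivative_inverse[OF _ this] f]
  have "((\<lambda>x. inverse (norm (f x)) *\<^sub>R f x) has_derivative
    (\<lambda>v. inverse (norm (f x)) *\<^sub>R f' v +
      (- (inverse (norm (f x)) * (sgn (f x) \<bullet> f' v) * inverse (norm (f x)))) *\<^sub>R f x)) (at x)"
    using nz by simp
  moreover have "- (inverse (norm (f x)) * (sgn (f x) \<bullet> f' v) * inverse (norm (f x))) =
      - (f x \<bullet> f' v / norm (f x) ^ 3)" for v
    using nz by (simp add: sgn_div_norm field_simps power3_eq_cube)
  ultimately show ?thesis
    by (simp add: sgn_div_norm)
qed

lemma norm_add_scaleR_sq:
  fixes x a :: "'b::real_inner"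
  assumes "norm x = 1" "norm a = 1"
  shows "(norm (x + t *\<^sub>R a))\<^sup>2 = 1 + 2 * t * (x \<bullet> a) + t\<^sup>2"
proof -
  have "x \<bullet> x = 1" "a \<bullet> a = 1" using assms by (simp_all add: dot_square_norm)
  then show ?thesis
    unfolding power2_norm_eq_inner
    by (simp add: inner_add_left inner_add_right inner_commute power2_eq_square)
qed

lemma add_scaleR_nonzero:
  fixes x a :: "'b::real_normed_vector"
  assumes "norm x = 1" "norm a = 1" "\<bar>t\<bar> < 1"
  shows "x + t *\<^sub>R a \<noteq> 0"
proof
  assume "x + t *\<^sub>R a = 0"
  then have "norm x = norm (t *\<^sub>R a)" by (metis add_eq_0_iff norm_minus_cancel)
  then show False using assms by simp
qed

text \<open>Let w = u + t a and r = |w|. Since u is orthogonal to its partial derivatives P_i, those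
  of w / r are P_i / r - t (P_i . a) w / r^3. In their inner products the two cross terms contribute
  -2 and the term with w . w contributes +1 times t^2 (P_i . a) (P_j . a) / r^4, which leaves the
  single negative term.\<close>

lemma norm_sq_differential_sgn_shift:
  fixes u :: "'a::t2_space \<Rightarrow> 'b::euclidean_space"
  assumes A: "smooth_atlas M A" and g: "riemannian_metric A g" and u: "smooth_in_charts A u"
    and un: "\<And>p. p \<in> M \<Longrightarrow> norm (u p) = 1" and a: "norm a = 1" and t: "\<bar>t\<bar> < 1" and p: "p \<in> M"
    and N: "N = 1 + 2 * t * (u p \<bullet> a) + t\<^sup>2"
  shows "norm_sq_differential A g (\<lambda>p. sgn (u p + t *\<^sub>R a)) p =
    norm_sq_differential A g u p / N - t\<^sup>2 * norm_sq_differential A g (\<lambda>p. u p \<bullet> a) p / N\<^sup>2"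
proof -
  obtain c where c: "c \<in> A" "p \<in> chart_dom c" using A p by (auto simp: smooth_atlas_def)
  note C = smooth_atlasD[OF A c(1)]
  let ?x = "chart_map c p" and ?w = "u p + t *\<^sub>R a"
  let ?P = "partial_deriv c u p" and ?r = "norm ?w"
  have nz: "u q + t *\<^sub>R a \<noteq> 0" if "q \<in> M" for q
    using add_scaleR_nonzero[OF un[OF that] a t] .
  then have r: "?r > 0" using p by simp
  have r2: "?r\<^sup>2 = N" unfolding N using un[OF p] a by (rule norm_add_scaleR_sq)
  have smooth: "smooth_in_charts A (\<lambda>p. sgn (u p + t *\<^sub>R a))"
    unfolding smooth_in_charts_def
  proof
    fix d assume d: "d \<in> A"
    note D = smooth_atlasD[OF A d]
    have "smooth_on (chart_ran d) (u \<circ> chart_inv d)"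
      using u d by (simp add: smooth_in_charts_def)
    then have "smooth_on (chart_ran d) (\<lambda>x. sgn ((u \<circ> chart_inv d) x + t *\<^sub>R a))"
    proof (intro smooth_on_sgn smooth_on_add smooth_on_const D(3))
      show "(u \<circ> chart_inv d) x + t *\<^sub>R a \<noteq> 0" if "x \<in> chart_ran d" for x
        using nz[OF subsetD[OF D(1) D(9)[OF that]]] by simp
    qed
    then show "smooth_on (chart_ran d) ((\<lambda>p. sgn (u p + t *\<^sub>R a)) \<circ> chart_inv d)"
      by (simp add: o_def)
  qed
  define F where "F = frechet_derivative (u \<circ> chart_inv c) (at ?x)"
  have F: "(u \<circ> chart_inv c has_derivative F) (at ?x)"
    unfolding F_def by (rule smooth_in_charts_has_derivative[OF A u c])
  have P: "?P i = F (axis i 1)" for i by (simp add: F_def partial_deriv_def)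
  have orth: "u p \<bullet> F v = 0" for v
  proof -
    have "((\<lambda>x. (u \<circ> chart_inv c) x \<bullet> (u \<circ> chart_inv c) x) has_derivative
      (\<lambda>v. (u \<circ> chart_inv c) ?x \<bullet> F v + F v \<bullet> (u \<circ> chart_inv c) ?x)) (at ?x)"
      by (rule has_derivative_inner[OF F F])
    moreover have "((\<lambda>x. (u \<circ> chart_inv c) x \<bullet> (u \<circ> chart_inv c) x) has_derivative (\<lambda>v. 0)) (at ?x)"
    proof (rule has_derivative_transform_within_open[OF has_derivative_const[of 1] C(3)])
      fix x assume "x \<in> chart_ran c"
      then have "chart_inv c x \<in> M" using C(1,9) by blast
      then show "1 = (u \<circ> chart_inv c) x \<bullet> (u \<circ> chart_inv c) x"
        using un by (simp add: dot_square_norm)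
    qed (use c in auto)
    ultimately have "(\<lambda>v. (u \<circ> chart_inv c) ?x \<bullet> F v + F v \<bullet> (u \<circ> chart_inv c) ?x) = (\<lambda>v. 0)"
      by (rule has_derivative_unique)
    from fun_cong[OF this, of v] show ?thesis using C(7)[OF c(2)] by (simp add: inner_commute)
  qed
  have wF: "?w \<bullet> F v = t * (F v \<bullet> a)" for v
    by (simp add: inner_add_left orth inner_commute[of a])
  have "((\<lambda>x. (u \<circ> chart_inv c) x + t *\<^sub>R a) has_derivative F) (at ?x)"
    using has_derivative_add[OF F has_derivative_const] by simp
  from has_derivative_sgn[OF this]
  have "((\<lambda>p. sgn (u p + t *\<^sub>R a)) \<circ> chart_inv c has_derivative
    (\<lambda>v. F v /\<^sub>R ?r - (?w \<bullet> F v / ?r ^ 3) *\<^sub>R ?w)) (at ?x)"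
    using C(7)[OF c(2)] nz[OF p] by (simp add: o_def)
  note D = fun_cong[OF frechet_derivative_at[OF this]]
  have Q: "partial_deriv c (\<lambda>p. sgn (u p + t *\<^sub>R a)) p i =
      ?P i /\<^sub>R ?r - (t * (?P i \<bullet> a) / ?r ^ 3) *\<^sub>R ?w" for i
    unfolding partial_deriv_def[of _ "\<lambda>p. sgn (u p + t *\<^sub>R a)"] P D[symmetric] wF
    by (rule refl)
  have QQ: "partial_deriv c (\<lambda>p. sgn (u p + t *\<^sub>R a)) p i \<bullet> partial_deriv c (\<lambda>p. sgn (u p + t *\<^sub>R a)) p j
    = (?P i \<bullet> ?P j) / N - t\<^sup>2 * ((?P i \<bullet> a) * (?P j \<bullet> a)) / N\<^sup>2" for i j
  proof -
    have w: "?P i \<bullet> ?w = t * (?P i \<bullet> a)" for i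
      using orth[of "axis i 1"] by (simp add: inner_add_right P inner_commute)
    have ww: "?w \<bullet> ?w = ?r\<^sup>2" by (simp add: dot_square_norm)
    have "(x /\<^sub>R r - k *\<^sub>R w) \<bullet> (y /\<^sub>R r - l *\<^sub>R w) =
      (x \<bullet> y) / r\<^sup>2 - l * (x \<bullet> w) / r - k * (y \<bullet> w) / r + k * l * (w \<bullet> w)"
      for x y w :: 'b and k l r :: real
      by (simp add: inner_diff_left inner_diff_right inner_commute power2_eq_square field_simps)
    then have "partial_deriv c (\<lambda>p. sgn (u p + t *\<^sub>R a)) p i \<bullet>
        partial_deriv c (\<lambda>p. sgn (u p + t *\<^sub>R a)) p j =
      (?P i \<bullet> ?P j) / ?r\<^sup>2 - (t * (?P j \<bullet> a) / ?r ^ 3) * (t * (?P i \<bullet> a)) / ?r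
      - (t * (?P i \<bullet> a) / ?r ^ 3) * (t * (?P j \<bullet> a)) / ?r
      + (t * (?P i \<bullet> a) / ?r ^ 3) * (t * (?P j \<bullet> a) / ?r ^ 3) * ?r\<^sup>2"
      unfolding Q by (simp only: w ww)
    also have "\<dots> = (?P i \<bullet> ?P j) / ?r\<^sup>2 - t\<^sup>2 * ((?P i \<bullet> a) * (?P j \<bullet> a)) / (?r\<^sup>2)\<^sup>2"
    proof -
      have "z / r\<^sup>2 - (t * y / r ^ 3) * (t * x) / r - (t * x / r ^ 3) * (t * y) / r
        + (t * x / r ^ 3) * (t * y / r ^ 3) * r\<^sup>2 = z / r\<^sup>2 - t\<^sup>2 * (x * y) / (r\<^sup>2)\<^sup>2"
        if "r > 0" for x y z r :: real
        using that by (simp add: field_simps power2_eq_square power3_eq_cube)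
      from this[OF r] show ?thesis .
    qed
    finally show ?thesis by (simp only: r2)
  qed
  have "matrix_inv (g c p) $ i $ j * (x / N - t\<^sup>2 * y / N\<^sup>2) =
    matrix_inv (g c p) $ i $ j * x / N - t\<^sup>2 * (matrix_inv (g c p) $ i $ j * y) / N\<^sup>2" for i j x y
    by (simp add: algebra_simps)
  then show ?thesis
    unfolding norm_sq_differential_chart[OF A g smooth c] norm_sq_differential_chart[OF A g u c] QQ
      norm_sq_differential_chart[OF A g smooth_in_charts_inner_const[OF A u] c]
      partial_deriv_inner_const[OF A u c]
    by (simp add: sum_subtractf sum_divide_distrib sum_distrib_left)
qed

section \<open>The volume measure and differentiation under the integral\<close>

lemma space_riemannian_volume:
  assumes "is_riemannian_volume M A g \<mu>"
  shows "space \<mu> = M"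
proof -
  have "sets \<mu> = sets (restrict_space borel M)" using assms by (simp add: is_riemannian_volume_def)
  then have "space \<mu> = space (restrict_space borel M)" by (rule sets_eq_imp_space_eq)
  then show ?thesis by (simp add: space_restrict_space)
qed

text \<open>The volume of the neighbourhood is the integral of the density over a coordinate ball.
  The closed ball still lies in the chart range, so by compactness the continuous density is bounded
  there.\<close>

lemma riemannian_volume_locally_finite:
  assumes A: "smooth_atlas M A" and g: "riemannian_metric A g"
    and \<mu>: "is_riemannian_volume M A g \<mu>" and p: "p \<in> M"
  obtains T where "open T" "p \<in> T" "M \<inter> T \<in> sets \<mu>" "emeasure \<mu> (M \<inter> T) < \<infinity>"
proof -
  obtain c where c: "c \<in> A" "p \<in> chart_dom c" using A p by (auto simp: smooth_atlas_def)
  note C = smooth_atlasD[OF A c(1)]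
  let ?x = "chart_map c p" and ?W = "\<lambda>x. sqrt (det (g c (chart_inv c x)))"
  obtain r where r: "r > 0" "cball ?x r \<subseteq> chart_ran c"
    using C(3) c(2) by (meson imageI open_contains_cball)
  let ?B = "chart_dom c \<inter> chart_map c -` ball ?x r"
  have "openin (top_of_set (chart_dom c)) ?B"
    using C(5) by (rule continuous_openin_preimage_gen) simp
  then have B: "openin (top_of_set M) ?B" using C(2) by (rule openin_trans)
  then obtain T where T: "open T" "?B = M \<inter> T" by (auto simp: openin_open)
  have BR: "?B \<in> sets \<mu>"
    using T \<mu> by (auto simp: is_riemannian_volume_def sets_restrict_space)
  have sub: "ball ?x r \<subseteq> chart_ran c" using r(2) ball_subset_cball by blast
  have img: "chart_map c ` ?B = ball ?x r"
  proof
    show "ball ?x r \<subseteq> chart_map c ` ?B"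
    proof
      fix x assume x: "x \<in> ball ?x r"
      then have "x \<in> chart_ran c" using sub by blast
      then show "x \<in> chart_map c ` ?B"
        using x C(8)[of x] C(9)[of x] by (intro image_eqI[of _ _ "chart_inv c x"]) simp_all
    qed
    show "chart_map c ` ?B \<subseteq> ball ?x r" by blast
  qed
  have "continuous_on (cball ?x r) ?W"
  proof (rule continuous_on_subset[OF _ r(2)])
    have "smooth_on (chart_ran c) (g c \<circ> chart_inv c)"
      using g c by (simp add: riemannian_metric_def)
    from smooth_on_imp_continuous_on[OF this]
    show "continuous_on (chart_ran c) ?W"
      by (intro continuous_on_real_sqrt continuous_on_matrix_det) (simp add: o_def)
  qed
  then have "bounded (?W ` cball ?x r)"
    by (intro compact_imp_bounded compact_continuous_image) auto
  then obtain K where "\<forall>y\<in>?W ` cball ?x r. norm y \<le> K" unfolding bounded_iff by blast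
  then have K: "\<bar>?W x\<bar> \<le> K" if "x \<in> cball ?x r" for x using that by simp
  have "emeasure \<mu> ?B = (\<integral>\<^sup>+ x\<in>chart_map c ` ?B. ennreal (?W x) \<partial>lborel)"
    using \<mu> c(1) BR unfolding is_riemannian_volume_def by blast
  also have "\<dots> \<le> (\<integral>\<^sup>+ x. ennreal K * indicator (ball ?x r) x \<partial>lborel)"
    unfolding img
  proof (intro nn_integral_mono)
    fix x show "ennreal (?W x) * indicator (ball ?x r) x \<le> ennreal K * indicator (ball ?x r) x"
      using K[of x] by (auto simp: indicator_def intro!: ennreal_leI)
  qed
  also have "\<dots> = ennreal K * emeasure lborel (ball ?x r)"
    by (simp add: nn_integral_cmult_indicator)
  also have "\<dots> < \<infinity>"
    using emeasure_lborel_ball_finite[of ?x r] by (simp add: ennreal_mult_less_top)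
  finally have "emeasure \<mu> (M \<inter> T) < \<infinity>" unfolding T(2) .
  moreover have "p \<in> T" using T(2) c(2) r(1) by auto
  ultimately show thesis using that T BR by simp
qed

text \<open>A finite subcover by neighbourhoods of finite volume. Finiteness is what lets constants
  serve as dominating functions.\<close>

lemma finite_riemannian_volume:
  assumes M: "compact M" and A: "smooth_atlas M A" and g: "riemannian_metric A g"
    and \<mu>: "is_riemannian_volume M A g \<mu>"
  shows "finite_measure \<mu>"
proof (rule finite_measureI)
  have "\<forall>p\<in>M. \<exists>T. open T \<and> p \<in> T \<and> M \<inter> T \<in> sets \<mu> \<and> emeasure \<mu> (M \<inter> T) < \<infinity>"
    using riemannian_volume_locally_finite[OF A g \<mu>] by metis
  then obtain T where T: "\<And>p. p \<in> M \<Longrightarrow> open (T p)" "\<And>p. p \<in> M \<Longrightarrow> p \<in> T p"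
    "\<And>p. p \<in> M \<Longrightarrow> M \<inter> T p \<in> sets \<mu>" "\<And>p. p \<in> M \<Longrightarrow> emeasure \<mu> (M \<inter> T p) < \<infinity>"
    by metis
  have "M \<subseteq> (\<Union>p\<in>M. T p)" using T(2) by blast
  then obtain C where C: "C \<subseteq> M" "finite C" "M \<subseteq> (\<Union>p\<in>C. T p)"
    using compactE_image[OF M] T(1) by metis
  have "M = (\<Union>p\<in>C. M \<inter> T p)" using C(3) by blast
  moreover have "emeasure \<mu> (\<Union>p\<in>C. M \<inter> T p) \<le> (\<Sum>p\<in>C. emeasure \<mu> (M \<inter> T p))"
    by (rule emeasure_subadditive_finite) (use C T(3) in auto)
  moreover have "(\<Sum>p\<in>C. emeasure \<mu> (M \<inter> T p)) < \<infinity>"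
    using C(1,2) T(4) by (auto simp: less_top[symmetric])
  ultimately show "emeasure \<mu> (space \<mu>) \<noteq> \<infinity>"
    using space_riemannian_volume[OF \<mu>] by (metis leD infinity_ennreal_def)
qed

text \<open>Turns strict negativity on an open set into a strict inequality of integrals. The
  density is strictly positive in a chart, so a null open set would have a Lebesgue null image, yet
  that image is open and nonempty.\<close>

lemma riemannian_volume_open_pos:
  assumes A: "smooth_atlas M A" and g: "riemannian_metric A g"
    and \<mu>: "is_riemannian_volume M A g \<mu>" and U: "openin (top_of_set M) U" "p \<in> U"
  shows "emeasure \<mu> U \<noteq> 0"
proof
  assume zero: "emeasure \<mu> U = 0"
  have sets: "V \<in> sets \<mu>" if "openin (top_of_set M) V" for V
    using that \<mu> by (auto simp: is_riemannian_volume_def sets_restrict_space openin_open)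
  have "p \<in> M" using openin_imp_subset[OF U(1)] U(2) by blast
  then obtain c where c: "c \<in> A" "p \<in> chart_dom c" using A by (auto simp: smooth_atlas_def)
  note C = smooth_atlasD[OF A c(1)]
  let ?V = "U \<inter> chart_dom c" and ?W = "\<lambda>x. sqrt (det (g c (chart_inv c x)))"
  have V: "openin (top_of_set M) ?V" using U(1) C(2) by (rule openin_Int)
  have img: "open (chart_map c ` ?V)" by (rule open_chart_image[OF A c(1) V]) simp
  have "emeasure \<mu> ?V \<le> emeasure \<mu> U" by (intro emeasure_mono sets U) auto
  then have "emeasure \<mu> ?V = 0" using zero by simp
  moreover have "emeasure \<mu> ?V = (\<integral>\<^sup>+ x\<in>chart_map c ` ?V. ennreal (?W x) \<partial>lborel)"
    using \<mu> c(1) sets[OF V] unfolding is_riemannian_volume_def by blast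
  ultimately have "(\<integral>\<^sup>+ x\<in>chart_map c ` ?V. ennreal (?W x) \<partial>lborel) = 0" by simp
  \<comment> \<open>The cut-off at the chart range changes nothing on the image of \<open>?V\<close>
    and produces the form of the density whose measurability is known.\<close>
  also have "(\<integral>\<^sup>+ x\<in>chart_map c ` ?V. ennreal (?W x) \<partial>lborel) =
    (\<integral>\<^sup>+ x\<in>chart_map c ` ?V. ennreal (indicator (chart_ran c) x * ?W x) \<partial>lborel)"
    by (intro nn_integral_cong) (auto simp: indicator_def)
  finally have "emeasure lborel {x\<in>space lborel.
      ennreal (indicator (chart_ran c) x * ?W x) * indicator (chart_map c ` ?V) x \<noteq> 0} = 0"
    using borel_measurable_volume_density[OF A g c(1)] img
    by (subst (asm) nn_integral_0_iff) (auto intro!: borel_measurable_times_ennreal)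
  also have "{x\<in>space lborel.
      ennreal (indicator (chart_ran c) x * ?W x) * indicator (chart_map c ` ?V) x \<noteq> 0} =
    chart_map c ` ?V"
  proof -
    have "?W (chart_map c q) > 0" if "q \<in> chart_dom c" for q
      using riemannian_metric_det_pos[OF g c(1) that] C(7)[OF that] by simp
    then have "ennreal (?W (chart_map c q)) \<noteq> 0" if "q \<in> chart_dom c" for q
      using that by (metis ennreal_eq_0_iff not_le)
    then have "ennreal (indicator (chart_ran c) x * ?W x) * indicator (chart_map c ` ?V) x \<noteq> 0 \<longleftrightarrow>
        x \<in> chart_map c ` ?V" for x
      by (cases "x \<in> chart_map c ` ?V") (auto simp: indicator_def)
    then show ?thesis by simp
  qed
  finally have "chart_map c ` ?V \<in> null_sets lborel" using img by (auto intro!: null_setsI)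
  then have "negligible (chart_map c ` ?V)"
    using negligible_iff_null_sets null_sets_completionI by blast
  then show False using open_not_negligible[OF img] U(2) c(2) by blast
qed

text \<open>Dominated convergence for difference quotients along sequences: the mean value
  inequality bounds them by \<open>B\<close>, and a constant is integrable for a finite
  measure.\<close>

lemma has_real_derivative_integral:
  fixes f f' :: "real \<Rightarrow> 'x \<Rightarrow> real"
  assumes fin: "finite_measure M" and d: "\<delta> > 0"
    and int: "\<And>s. \<bar>s - t\<bar> < \<delta> \<Longrightarrow> integrable M (f s)"
    and der: "\<And>s x. \<bar>s - t\<bar> < \<delta> \<Longrightarrow> x \<in> space M \<Longrightarrow> ((\<lambda>s. f s x) has_real_derivative f' s x) (at s)"
    and bound: "\<And>s x. \<bar>s - t\<bar> < \<delta> \<Longrightarrow> x \<in> space M \<Longrightarrow> \<bar>f' s x\<bar> \<le> B"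
    and meas: "f' t \<in> borel_measurable M"
  shows "((\<lambda>s. \<integral>x. f s x \<partial>M) has_real_derivative (\<integral>x. f' t x \<partial>M)) (at t)"
  unfolding DERIV_def tendsto_at_iff_sequentially
proof (intro allI impI)
  fix X :: "nat \<Rightarrow> real" assume X: "\<forall>i. X i \<in> UNIV - {0}" "X \<longlonglongrightarrow> 0"
  have "\<forall>\<^sub>F n in sequentially. dist (X n) 0 < \<delta>" using X(2) d by (rule tendstoD)
  then obtain n0 where n0: "\<And>n. n \<ge> n0 \<Longrightarrow> \<bar>X n\<bar> < \<delta>"
    unfolding eventually_sequentially by auto
  \<comment> \<open>The dominating bound must hold for every index, so the terms before
    \<open>n0\<close>, where t + X n may leave the interval, are dropped.\<close>
  let ?Y = "\<lambda>n. X (n + n0)"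
  have Y: "?Y n \<noteq> 0" "\<bar>?Y n\<bar> < \<delta>" for n using X(1) n0[of "n + n0"] by auto
  have "(\<lambda>n. \<integral>x. (f (t + ?Y n) x - f t x) / ?Y n \<partial>M) \<longlonglongrightarrow> (\<integral>x. f' t x \<partial>M)"
  proof (rule integral_dominated_convergence[where w = "\<lambda>x. B"])
    show "integrable M (\<lambda>x. B)" using fin by (simp add: finite_measure.integrable_const)
    show "(\<lambda>x. (f (t + ?Y n) x - f t x) / ?Y n) \<in> borel_measurable M" for n
    proof -
      have "f (t + ?Y n) \<in> borel_measurable M" "f t \<in> borel_measurable M"
        using int[of "t + ?Y n"] int[of t] Y(2)[of n] d by auto
      then show ?thesis
        by (intro borel_measurable_divide borel_measurable_diff borel_measurable_const)
    qed
    show "AE x in M. (\<lambda>n. (f (t + ?Y n) x - f t x) / ?Y n) \<longlonglongrightarrow> f' t x"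
    proof (rule AE_I2)
      fix x assume x: "x \<in> space M"
      have "((\<lambda>h. (f (t + h) x - f t x) / h) \<longlongrightarrow> f' t x) (at 0)"
        using der[of t x] x d by (simp add: DERIV_def)
      from tendsto_at_iff_sequentially[THEN iffD1, OF this, rule_format, OF _ X(2)] X(1)
      have "(\<lambda>n. (f (t + X n) x - f t x) / X n) \<longlonglongrightarrow> f' t x"
        by (simp add: o_def)
      then show "(\<lambda>n. (f (t + ?Y n) x - f t x) / ?Y n) \<longlonglongrightarrow> f' t x"
        by (rule LIMSEQ_ignore_initial_segment)
    qed
    show "AE x in M. norm ((f (t + ?Y n) x - f t x) / ?Y n) \<le> B" for n
    proof (rule AE_I2)
      fix x assume x: "x \<in> space M"
      have mem: "t \<in> {t - \<delta><..<t + \<delta>}" "t + ?Y n \<in> {t - \<delta><..<t + \<delta>}"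
        using abs_less_iff[THEN iffD1, OF Y(2)[of n]] d by simp_all
      have "norm (f (t + ?Y n) x - f t x) \<le> B * norm (t + ?Y n - t)"
      proof (rule field_differentiable_bound[where f = "\<lambda>s. f s x" and f' = "\<lambda>s. f' s x",
            OF _ _ _ mem(2,1)])
        show "((\<lambda>s. f s x) has_field_derivative f' s x) (at s within {t - \<delta><..<t + \<delta>})"
          if "s \<in> {t - \<delta><..<t + \<delta>}" for s
          using that by (intro has_field_derivative_at_within[OF der[OF _ x]]) (simp add: abs_less_iff)
        show "norm (f' s x) \<le> B" if "s \<in> {t - \<delta><..<t + \<delta>}" for s
          using that bound[OF _ x, of s] by (simp add: abs_less_iff)
      qed (rule convex_real_interval)
      then show "norm ((f (t + ?Y n) x - f t x) / ?Y n) \<le> B"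
        using Y(1)[of n] by (simp add: divide_le_eq)
    qed
  qed (rule meas)
  moreover have "(\<integral>x. (f (t + ?Y n) x - f t x) / ?Y n \<partial>M) =
      ((\<integral>x. f (t + ?Y n) x \<partial>M) - (\<integral>x. f t x \<partial>M)) / ?Y n" for n
    using int[of "t + ?Y n"] int[of t] Y(2)[of n] d by simp
  ultimately have "(\<lambda>n. ((\<integral>x. f (t + ?Y n) x \<partial>M) - (\<integral>x. f t x \<partial>M)) / ?Y n)
      \<longlonglongrightarrow> (\<integral>x. f' t x \<partial>M)" by (simp only:)
  from LIMSEQ_offset[OF this]
  show "((\<lambda>h. ((\<integral>x. f (t + h) x \<partial>M) - (\<integral>x. f t x \<partial>M)) / h) \<circ> X)
      \<longlonglongrightarrow> (\<integral>x. f' t x \<partial>M)" by (simp add: o_def)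
qed

section \<open>The energy density along the variation\<close>

text \<open>\<open>shift_nsq f t\<close> and \<open>shift_dens e q f t\<close> are \<open>\<bar>\<psi> + t a\<bar>\<^sup>2\<close> and \<open>1 + \<bar>d\<psi>\<^sub>t\<bar>\<^sup>2\<close>; the suffixes 1 and 2
  mark the first and second derivatives in \<open>t\<close>.\<close>

definition shift_nsq :: "real \<Rightarrow> real \<Rightarrow> real" where
  "shift_nsq f t = 1 + 2 * t * f + t\<^sup>2"

definition shift_dens :: "real \<Rightarrow> real \<Rightarrow> real \<Rightarrow> real \<Rightarrow> real" where
  "shift_dens e q f t = 1 + (e / shift_nsq f t - t\<^sup>2 * q / (shift_nsq f t)\<^sup>2)"

definition shift_dens1 :: "real \<Rightarrow> real \<Rightarrow> real \<Rightarrow> real \<Rightarrow> real" where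
  "shift_dens1 e q f t = - (e * (2 * f + 2 * t)) / (shift_nsq f t)\<^sup>2 - 2 * t * q / (shift_nsq f t)\<^sup>2
     + 2 * t\<^sup>2 * q * (2 * f + 2 * t) / (shift_nsq f t) ^ 3"

definition shift_dens2 :: "real \<Rightarrow> real \<Rightarrow> real \<Rightarrow> real \<Rightarrow> real" where
  "shift_dens2 e q f t = - (2 * e) / (shift_nsq f t)\<^sup>2 + 2 * e * (2 * f + 2 * t)\<^sup>2 / (shift_nsq f t) ^ 3
     - 2 * q / (shift_nsq f t)\<^sup>2 + 8 * t * q * (2 * f + 2 * t) / (shift_nsq f t) ^ 3
     + 4 * t\<^sup>2 * q / (shift_nsq f t) ^ 3 - 6 * t\<^sup>2 * q * (2 * f + 2 * t)\<^sup>2 / (shift_nsq f t) ^ 4"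

definition alpha_dens :: "real \<Rightarrow> real \<Rightarrow> real \<Rightarrow> real \<Rightarrow> real \<Rightarrow> real" where
  "alpha_dens \<alpha> e q f t = shift_dens e q f t powr \<alpha>"

definition alpha_dens1 :: "real \<Rightarrow> real \<Rightarrow> real \<Rightarrow> real \<Rightarrow> real \<Rightarrow> real" where
  "alpha_dens1 \<alpha> e q f t = \<alpha> * shift_dens e q f t powr (\<alpha> - 1) * shift_dens1 e q f t"

definition alpha_dens2 :: "real \<Rightarrow> real \<Rightarrow> real \<Rightarrow> real \<Rightarrow> real \<Rightarrow> real" where
  "alpha_dens2 \<alpha> e q f t = \<alpha> * ((\<alpha> - 1) * shift_dens e q f t powr (\<alpha> - 2) * (shift_dens1 e q f t)\<^sup>2
     + shift_dens e q f t powr (\<alpha> - 1) * shift_dens2 e q f t)"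

text \<open>The origin of 1/4: it gives |2 t f| \<le> 1/2 and so keeps N away from 0.\<close>

lemma shift_nsq_ge:
  assumes "\<bar>f\<bar> \<le> 1" "\<bar>t\<bar> \<le> 1/4"
  shows "shift_nsq f t \<ge> 1/2" "t\<^sup>2 \<le> shift_nsq f t"
proof -
  have "\<bar>t * f\<bar> \<le> 1/4 * 1"
    unfolding abs_mult using assms by (intro mult_mono) auto
  then have *: "1 + 2 * t * f \<ge> 1/2" by (simp add: abs_le_iff mult.assoc)
  then show "shift_nsq f t \<ge> 1/2" "t\<^sup>2 \<le> shift_nsq f t"
    unfolding shift_nsq_def using zero_le_power2[of t] by linarith+
qed

text \<open>From t^2 \<le> N and q \<le> e follows t^2 q \<le> N e, so the squared norm of the moved
  differential is nonnegative. The base of the real power thus never drops below 1, and the power is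
  differentiable for every exponent.\<close>

lemma shift_dens_ge_1:
  assumes "\<bar>f\<bar> \<le> 1" "\<bar>t\<bar> \<le> 1/4" "0 \<le> q" "q \<le> e"
  shows "shift_dens e q f t \<ge> 1"
proof -
  let ?N = "shift_nsq f t"
  have N: "?N \<ge> 1/2" "t\<^sup>2 \<le> ?N" using shift_nsq_ge[OF assms(1,2)] by auto
  have "t\<^sup>2 * q \<le> ?N * e" using N assms(3,4) by (intro mult_mono) auto
  moreover have "e / ?N - t\<^sup>2 * q / ?N\<^sup>2 = (?N * e - t\<^sup>2 * q) / ?N\<^sup>2"
    using N(1) by (simp add: field_simps power2_eq_square)
  ultimately show ?thesis by (simp add: shift_dens_def)
qed

lemma has_real_derivative_shift_nsq: "(shift_nsq f has_real_derivative 2 * f + 2 * t) (at t)"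
  unfolding shift_nsq_def[abs_def] by (auto intro!: derivative_eq_intros)

lemma has_real_derivative_shift_dens:
  assumes "shift_nsq f t \<noteq> 0"
  shows "(shift_dens e q f has_real_derivative shift_dens1 e q f t) (at t)"
  unfolding shift_dens_def[abs_def]
  by (rule derivative_eq_intros has_real_derivative_shift_nsq refl | use assms in force)+
    (use assms in \<open>simp add: shift_dens1_def field_simps power2_eq_square power3_eq_cube power4_eq_xxxx\<close>)

lemma has_real_derivative_shift_dens1:
  assumes "shift_nsq f t \<noteq> 0"
  shows "(shift_dens1 e q f has_real_derivative shift_dens2 e q f t) (at t)"
  unfolding shift_dens1_def[abs_def]
  by (rule derivative_eq_intros has_real_derivative_shift_nsq refl | use assms in force)+
    (use assms in \<open>simp add: shift_dens2_def field_simps power2_eq_square power3_eq_cube power4_eq_xxxx\<close>)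

lemma has_real_derivative_alpha_dens:
  assumes "shift_nsq f t \<noteq> 0" "shift_dens e q f t > 0"
  shows "(alpha_dens \<alpha> e q f has_real_derivative alpha_dens1 \<alpha> e q f t) (at t)"
  unfolding alpha_dens_def[abs_def] alpha_dens1_def
  using DERIV_chain2[OF has_real_derivative_powr[OF assms(2)] has_real_derivative_shift_dens[OF assms(1)]]
  by simp

lemma has_real_derivative_alpha_dens1:
  assumes "shift_nsq f t \<noteq> 0" "shift_dens e q f t > 0"
  shows "(alpha_dens1 \<alpha> e q f has_real_derivative alpha_dens2 \<alpha> e q f t) (at t)"
proof -
  have "((\<lambda>t. \<alpha> * (shift_dens e q f t powr (\<alpha> - 1) * shift_dens1 e q f t)) has_real_derivative
    \<alpha> * ((\<alpha> - 1) * shift_dens e q f t powr (\<alpha> - 1 - 1) * shift_dens1 e q f t * shift_dens1 e q f t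
      + shift_dens2 e q f t * shift_dens e q f t powr (\<alpha> - 1))) (at t)"
    by (intro DERIV_cmult DERIV_mult has_real_derivative_shift_dens1 assms
        DERIV_chain2[OF has_real_derivative_powr[OF assms(2)] has_real_derivative_shift_dens[OF assms(1)]])
  then show ?thesis
    by (simp add: alpha_dens1_def[abs_def] alpha_dens2_def power2_eq_square mult_ac)
qed

text \<open>The point of the manifold enters the densities only through the numbers e, q and f, so a
  uniform bound is the boundedness of continuous functions on a compact subset of R^4. The
  constraint q \<le> e is part of that set because it keeps the base of the power positive.\<close>

lemma alpha_dens_bounded:
  obtains B where "\<And>e q f t. \<bar>f\<bar> \<le> 1 \<Longrightarrow> \<bar>t\<bar> \<le> 1/4 \<Longrightarrow> 0 \<le> q \<Longrightarrow> q \<le> e \<Longrightarrow> e \<le> K \<Longrightarrow>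
    \<bar>alpha_dens \<alpha> e q f t\<bar> \<le> B \<and> \<bar>alpha_dens1 \<alpha> e q f t\<bar> \<le> B \<and> \<bar>alpha_dens2 \<alpha> e q f t\<bar> \<le> B"
proof -
  define Z where "Z = ({0..K} \<times> {0..K} \<times> {-1..1} \<times> {-1/4..1/4}) \<inter>
    {z :: real \<times> real \<times> real \<times> real. fst (snd z) \<le> fst z}"
  have "closed {z :: real \<times> real \<times> real \<times> real. fst (snd z) \<le> fst z}"
    by (intro closed_Collect_le continuous_intros)
  then have Z: "compact Z"
    unfolding Z_def by (intro compact_Int_closed compact_Times) auto
  have nz: "shift_nsq (fst (snd (snd z))) (snd (snd (snd z))) \<noteq> 0" if "z \<in> Z" for z
  proof -
    have "\<bar>fst (snd (snd z))\<bar> \<le> 1" "\<bar>snd (snd (snd z))\<bar> \<le> 1/4"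
      using that by (auto simp: Z_def abs_le_iff)
    from shift_nsq_ge(1)[OF this] show ?thesis by auto
  qed
  have dz: "shift_dens (fst z) (fst (snd z)) (fst (snd (snd z))) (snd (snd (snd z))) \<noteq> 0"
    if "z \<in> Z" for z
  proof -
    have "\<bar>fst (snd (snd z))\<bar> \<le> 1" "\<bar>snd (snd (snd z))\<bar> \<le> 1/4" "0 \<le> fst (snd z)" "fst (snd z) \<le> fst z"
      using that by (auto simp: Z_def abs_le_iff)
    from shift_dens_ge_1[OF this] show ?thesis by auto
  qed
  have cN: "continuous_on Z (\<lambda>z. shift_nsq (fst (snd (snd z))) (snd (snd (snd z))))"
    unfolding shift_nsq_def by (intro continuous_intros)
  have cd: "continuous_on Z (\<lambda>z. shift_dens (fst z) (fst (snd z)) (fst (snd (snd z))) (snd (snd (snd z))))"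
    unfolding shift_dens_def by (intro continuous_intros cN) (use nz in auto)
  have c1: "continuous_on Z (\<lambda>z. shift_dens1 (fst z) (fst (snd z)) (fst (snd (snd z))) (snd (snd (snd z))))"
    unfolding shift_dens1_def by (intro continuous_intros cN) (use nz in auto)
  have c2: "continuous_on Z (\<lambda>z. shift_dens2 (fst z) (fst (snd z)) (fst (snd (snd z))) (snd (snd (snd z))))"
    unfolding shift_dens2_def by (intro continuous_intros cN) (use nz in auto)
  have bounded: "\<exists>B. \<forall>z\<in>Z. \<bar>h z\<bar> \<le> B" if "continuous_on Z h" for h :: "_ \<Rightarrow> real"
    using compact_imp_bounded[OF compact_continuous_image[OF that Z]] by (auto simp: bounded_iff)
  have "continuous_on Z (\<lambda>z. alpha_dens \<alpha> (fst z) (fst (snd z)) (fst (snd (snd z))) (snd (snd (snd z))))"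
    unfolding alpha_dens_def by (intro continuous_intros cd) (use dz in auto)
  then obtain B0 where B0: "\<And>z. z \<in> Z \<Longrightarrow>
    \<bar>alpha_dens \<alpha> (fst z) (fst (snd z)) (fst (snd (snd z))) (snd (snd (snd z)))\<bar> \<le> B0"
    using bounded by meson
  have "continuous_on Z (\<lambda>z. alpha_dens1 \<alpha> (fst z) (fst (snd z)) (fst (snd (snd z))) (snd (snd (snd z))))"
    unfolding alpha_dens1_def by (intro continuous_intros cd c1) (use dz in auto)
  then obtain B1 where B1: "\<And>z. z \<in> Z \<Longrightarrow>
    \<bar>alpha_dens1 \<alpha> (fst z) (fst (snd z)) (fst (snd (snd z))) (snd (snd (snd z)))\<bar> \<le> B1"
    using bounded by meson
  have "continuous_on Z (\<lambda>z. alpha_dens2 \<alpha> (fst z) (fst (snd z)) (fst (snd (snd z))) (snd (snd (snd z))))"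
    unfolding alpha_dens2_def by (intro continuous_intros cd c1 c2) (use dz in auto)
  then obtain B2 where B2: "\<And>z. z \<in> Z \<Longrightarrow>
    \<bar>alpha_dens2 \<alpha> (fst z) (fst (snd z)) (fst (snd (snd z))) (snd (snd (snd z)))\<bar> \<le> B2"
    using bounded by meson
  show thesis
  proof (rule that[of "max B0 (max B1 B2)"])
    fix e q f t :: real
    assume "\<bar>f\<bar> \<le> 1" "\<bar>t\<bar> \<le> 1/4" "0 \<le> q" "q \<le> e" "e \<le> K"
    then have "(e, q, f, t) \<in> Z" by (auto simp: Z_def abs_le_iff)
    from B0[OF this] B1[OF this] B2[OF this]
    show "\<bar>alpha_dens \<alpha> e q f t\<bar> \<le> max B0 (max B1 B2) \<and> \<bar>alpha_dens1 \<alpha> e q f t\<bar> \<le> max B0 (max B1 B2)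
        \<and> \<bar>alpha_dens2 \<alpha> e q f t\<bar> \<le> max B0 (max B1 B2)" by auto
  qed
qed

text \<open>At t = 0 one has N = 1, and the base and its first two derivatives are 1 + e, -2 e f and
  8 e f^2 - 2 e - 2 q. A factor 1 + e is split off the power \<alpha> - 1 to leave the common power
  \<alpha> - 2.\<close>

lemma alpha_dens2_0:
  assumes "e \<ge> 0"
  shows "alpha_dens2 \<alpha> e q f 0 = 2 * \<alpha> * (1 + e) powr (\<alpha> - 2) *
    (2 * (\<alpha> - 1) * e\<^sup>2 * f\<^sup>2 + (1 + e) * (4 * e * f\<^sup>2 - e - q))"
proof -
  have "(1 + e) powr (\<alpha> - 1) = (1 + e) powr (\<alpha> - 2) * (1 + e)"
    using assms powr_add[of "1 + e" "\<alpha> - 2" 1] by simp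
  then show ?thesis
    by (simp add: alpha_dens2_def shift_dens_def shift_dens1_def shift_dens2_def shift_nsq_def power2_eq_square algebra_simps)
qed

section \<open>The second variation\<close>

lemma borel_measurable_alpha_dens:
  fixes e q f :: "'x \<Rightarrow> real"
  assumes [measurable]: "e \<in> borel_measurable M" "q \<in> borel_measurable M" "f \<in> borel_measurable M"
  shows "(\<lambda>x. alpha_dens \<alpha> (e x) (q x) (f x) t) \<in> borel_measurable M"
    "(\<lambda>x. alpha_dens1 \<alpha> (e x) (q x) (f x) t) \<in> borel_measurable M"
    "(\<lambda>x. alpha_dens2 \<alpha> (e x) (q x) (f x) t) \<in> borel_measurable M"
  unfolding alpha_dens_def alpha_dens1_def alpha_dens2_def shift_dens_def shift_dens1_def shift_dens2_def shift_nsq_def by measurable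

text \<open>\<open>G\<close> stands for the energy of the moved map as a function of one parameter.
  With argument t + s the mixed derivative is its second derivative, found by differentiating twice
  under the integral.\<close>

lemma deriv_deriv_integral_alpha_dens:
  fixes e q f :: "'x \<Rightarrow> real" and G :: "real \<Rightarrow> real"
  assumes fin: "finite_measure M"
    and meas: "e \<in> borel_measurable M" "q \<in> borel_measurable M" "f \<in> borel_measurable M"
    and bounds: "\<And>x. x \<in> space M \<Longrightarrow> 0 \<le> q x" "\<And>x. x \<in> space M \<Longrightarrow> q x \<le> e x"
      "\<And>x. x \<in> space M \<Longrightarrow> e x \<le> K" "\<And>x. x \<in> space M \<Longrightarrow> \<bar>f x\<bar> \<le> 1"
    and G: "\<And>t. \<bar>t\<bar> < 1/4 \<Longrightarrow> G t = (\<integral>x. alpha_dens \<alpha> (e x) (q x) (f x) t \<partial>M)"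
  shows "deriv (\<lambda>t. deriv (\<lambda>s. G (t + s)) 0) 0 = (\<integral>x. alpha_dens2 \<alpha> (e x) (q x) (f x) 0 \<partial>M)"
    and "integrable M (\<lambda>x. alpha_dens2 \<alpha> (e x) (q x) (f x) 0)"
proof -
  note m = borel_measurable_alpha_dens[OF meas]
  obtain B where "\<And>e q f t. \<bar>f\<bar> \<le> 1 \<Longrightarrow> \<bar>t\<bar> \<le> 1/4 \<Longrightarrow> 0 \<le> q \<Longrightarrow> q \<le> e \<Longrightarrow> e \<le> K \<Longrightarrow>
    \<bar>alpha_dens \<alpha> e q f t\<bar> \<le> B \<and> \<bar>alpha_dens1 \<alpha> e q f t\<bar> \<le> B \<and> \<bar>alpha_dens2 \<alpha> e q f t\<bar> \<le> B"
    by (rule alpha_dens_bounded[where K = K and \<alpha> = \<alpha>]) blast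
  then have B: "\<bar>alpha_dens \<alpha> (e x) (q x) (f x) t\<bar> \<le> B" "\<bar>alpha_dens1 \<alpha> (e x) (q x) (f x) t\<bar> \<le> B"
    "\<bar>alpha_dens2 \<alpha> (e x) (q x) (f x) t\<bar> \<le> B" if "x \<in> space M" "\<bar>t\<bar> < 1/4" for x t
    using bounds[OF that(1)] that(2) by simp_all
  have int: "integrable M (\<lambda>x. alpha_dens \<alpha> (e x) (q x) (f x) t)"
    "integrable M (\<lambda>x. alpha_dens1 \<alpha> (e x) (q x) (f x) t)"
    "integrable M (\<lambda>x. alpha_dens2 \<alpha> (e x) (q x) (f x) t)" if "\<bar>t\<bar> < 1/4" for t
    using B[OF _ that] m
    by (intro finite_measure.integrable_const_bound[OF fin, of _ B] AE_I2; simp)+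
  have pos: "shift_nsq (f x) t \<noteq> 0" "shift_dens (e x) (q x) (f x) t > 0" if "x \<in> space M" "\<bar>t\<bar> < 1/4" for x t
    using shift_nsq_ge(1)[of "f x" t] shift_dens_ge_1[of "f x" t "q x" "e x"] bounds[OF that(1)] that(2) by auto
  \<comment> \<open>The interval of radius 1/4 - |t| around t stays within (-1/4, 1/4), where all
    bounds hold.\<close>
  have near: "\<bar>s\<bar> < 1/4" if "\<bar>s - t\<bar> < 1/4 - \<bar>t\<bar>" for s t :: real using that by arith
  let ?D1 = "\<lambda>t. \<integral>x. alpha_dens1 \<alpha> (e x) (q x) (f x) t \<partial>M"
  have d1: "((\<lambda>t. \<integral>x. alpha_dens \<alpha> (e x) (q x) (f x) t \<partial>M) has_real_derivative ?D1 t) (at t)"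
    if "\<bar>t\<bar> < 1/4" for t
    using that
    by (intro has_real_derivative_integral[OF fin, of "1/4 - \<bar>t\<bar>" _ _ _ B] int(1) m(2)
        has_real_derivative_alpha_dens pos B(2)) (simp_all add: near)
  have d2: "(?D1 has_real_derivative (\<integral>x. alpha_dens2 \<alpha> (e x) (q x) (f x) 0 \<partial>M)) (at 0)"
    by (intro has_real_derivative_integral[OF fin, of "1/4" _ _ _ B] int(2) m(3)
        has_real_derivative_alpha_dens1 pos B(3)) simp_all
  have "deriv (\<lambda>s. G (t + s)) 0 = ?D1 t" if t: "\<bar>t\<bar> < 1/4" for t
  proof (rule DERIV_imp_deriv)
    have "(G has_real_derivative ?D1 t) (at t)"
    proof (rule has_field_derivative_transform_within_open[OF d1[OF t], of "{-1/4<..<1/4}"])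
      show "(\<integral>x. alpha_dens \<alpha> (e x) (q x) (f x) s \<partial>M) = G s" if "s \<in> {-1/4<..<1/4}" for s
      proof -
        have "\<bar>s\<bar> < 1/4" using that unfolding greaterThanLessThan_iff by arith
        then show ?thesis by (rule G[symmetric])
      qed
      show "t \<in> {-1/4<..<1/4}" using t unfolding greaterThanLessThan_iff by arith
    qed simp
    then show "((\<lambda>s. G (t + s)) has_real_derivative ?D1 t) (at 0)"
      using DERIV_shift[of G "?D1 t" 0 t] by (simp add: add.commute)
  qed
  \<comment> \<open>The inner derivative is known only for small t; the outer one at 0 requires
    equality only near 0.\<close>
  then have "\<forall>\<^sub>F t in nhds 0. deriv (\<lambda>s. G (t + s)) 0 = ?D1 t"
    by (auto simp: eventually_nhds_metric dist_real_def intro!: exI[of _ "1/4"])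
  then have "deriv (\<lambda>t. deriv (\<lambda>s. G (t + s)) 0) 0 = deriv ?D1 0"
    by (rule deriv_cong_ev) simp
  then show "deriv (\<lambda>t. deriv (\<lambda>s. G (t + s)) 0) 0 = (\<integral>x. alpha_dens2 \<alpha> (e x) (q x) (f x) 0 \<partial>M)"
    using DERIV_imp_deriv[OF d2] by simp
  show "integrable M (\<lambda>x. alpha_dens2 \<alpha> (e x) (q x) (f x) 0)" by (rule int(3)) simp
qed

section \<open>The two-parameter variation and its field\<close>

lemma smooth_variation2_sgn_shift:
  fixes \<psi> :: "'a::t2_space \<Rightarrow> 'b::euclidean_space"
  assumes A: "smooth_atlas M A" and \<psi>: "smooth_map_to_sphere M A \<psi>" and a: "norm a = 1"
  shows "smooth_variation2 M A \<psi> (1/4) (\<lambda>t s p. sgn (\<psi> p + (t + s) *\<^sub>R a))"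
proof -
  let ?I = "{-1/4<..<1/4::real}"
  have un: "norm (\<psi> p) = 1" if "p \<in> M" for p
    using \<psi> that by (auto simp: smooth_map_to_sphere_def Pi_iff)
  \<comment> \<open>Here |t + s| < 1/2 < 1, so the translate of a unit vector misses the
    origin.\<close>
  have nz: "\<psi> p + (t + s) *\<^sub>R a \<noteq> 0" if "p \<in> M" "t \<in> ?I" "s \<in> ?I" for p t s
    using that by (intro add_scaleR_nonzero un a) (auto simp: abs_less_iff)
  have smooth: "smooth_on (?I \<times> ?I \<times> chart_ran c)
      (\<lambda>(t, s, x). sgn (\<psi> (chart_inv c x) + (t + s) *\<^sub>R a))" if c: "c \<in> A" for c
  proof -
    note C = smooth_atlasD[OF A c]
    have o: "open (?I \<times> ?I \<times> chart_ran c)" using C(3) by (intro open_Times) auto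
    have s\<psi>: "smooth_on (chart_ran c) (\<psi> \<circ> chart_inv c)"
      using \<psi> c by (simp add: smooth_map_to_sphere_def)
    have "smooth_on (?I \<times> ?I \<times> chart_ran c)
      (\<lambda>z. sgn ((\<psi> \<circ> chart_inv c) (snd (snd z)) + (fst z + fst (snd z)) *\<^sub>R a))"
    proof (intro smooth_on_sgn smooth_on_add smooth_on_scaleR smooth_on_const o
        smooth_on_compose_linear[OF o _ _ s\<psi>] smooth_on_linear)
      show "bounded_linear (\<lambda>z. snd (snd z))"
        by (rule bounded_linear_compose[OF bounded_linear_snd bounded_linear_snd])
      show "bounded_linear (\<lambda>z. fst (snd z))"
        by (rule bounded_linear_compose[OF bounded_linear_fst bounded_linear_snd])
      fix z assume z: "z \<in> ?I \<times> ?I \<times> chart_ran c"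
      then show "snd (snd z) \<in> chart_ran c" by auto
      then have "chart_inv c (snd (snd z)) \<in> M" using C(1,9) by blast
      then show "(\<psi> \<circ> chart_inv c) (snd (snd z)) + (fst z + fst (snd z)) *\<^sub>R a \<noteq> 0"
        using z nz by auto
    qed (rule bounded_linear_fst)
    then show ?thesis by (simp add: case_prod_unfold)
  qed
  have "sgn (\<psi> p + (t + s) *\<^sub>R a) \<in> sphere 0 1" if "p \<in> M" "t \<in> ?I" "s \<in> ?I" for p t s
    using nz[OF that] by (simp add: norm_sgn)
  then show ?thesis
    unfolding smooth_variation2_def using smooth un by (auto simp: sgn_div_norm)
qed

lemma vector_field_along_projection:
  fixes \<psi> :: "'a::t2_space \<Rightarrow> 'b::euclidean_space"
  assumes A: "smooth_atlas M A" and \<psi>: "smooth_map_to_sphere M A \<psi>"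
  shows "vector_field_along M A \<psi> (\<lambda>p. a - (\<psi> p \<bullet> a) *\<^sub>R \<psi> p)"
  unfolding vector_field_along_def
proof (intro conjI ballI)
  fix p assume "p \<in> M"
  then have "\<psi> p \<bullet> \<psi> p = 1"
    using \<psi> by (auto simp: smooth_map_to_sphere_def Pi_iff dot_square_norm)
  then show "(a - (\<psi> p \<bullet> a) *\<^sub>R \<psi> p) \<bullet> \<psi> p = 0"
    by (simp add: inner_diff_left inner_commute[of a])
next
  fix c assume c: "c \<in> A"
  have "smooth_on (chart_ran c) (\<psi> \<circ> chart_inv c)"
    using \<psi> c by (simp add: smooth_map_to_sphere_def)
  \<comment> \<open>The subtraction is written as addition of a multiple with \<open>- a\<close> in
    the inner product, to stay within the closure rules for sums and products.\<close>
  then have "smooth_on (chart_ran c)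
    (\<lambda>x. a + ((\<psi> \<circ> chart_inv c) x \<bullet> (- a)) *\<^sub>R (\<psi> \<circ> chart_inv c) x)"
    by (intro smooth_on_add smooth_on_scaleR smooth_on_inner smooth_on_const smooth_atlasD(3)[OF A c])
  then show "smooth_on (chart_ran c) ((\<lambda>p. a - (\<psi> p \<bullet> a) *\<^sub>R \<psi> p) \<circ> chart_inv c)"
    by (simp add: o_def)
qed

lemma has_vector_derivative_sgn_shift:
  fixes x a :: "'b::euclidean_space"
  assumes "norm x = 1"
  shows "((\<lambda>t. sgn (x + t *\<^sub>R a)) has_vector_derivative (a - (x \<bullet> a) *\<^sub>R x)) (at 0)"
proof -
  have "((\<lambda>t. x + t *\<^sub>R a) has_derivative (\<lambda>h. h *\<^sub>R a)) (at 0)"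
    by (auto intro!: derivative_eq_intros)
  from has_derivative_sgn[OF this] assms show ?thesis
    by (force simp: has_vector_derivative_def algebra_simps)
qed

text \<open>The family depends on t + s alone, so both parameters produce the same field, as I(v, v)
  requires. The value stays an iterated \<open>deriv\<close>; its evaluation as an integral is a
  separate matter.\<close>

lemma second_variation_projection:
  fixes \<psi> :: "'a::t2_space \<Rightarrow> 'b::euclidean_space"
  assumes A: "smooth_atlas M A" and \<psi>: "smooth_map_to_sphere M A \<psi>" and a: "norm a = 1"
  shows "second_variation \<alpha> M A g \<psi> (\<lambda>p. a - (\<psi> p \<bullet> a) *\<^sub>R \<psi> p) (\<lambda>p. a - (\<psi> p \<bullet> a) *\<^sub>R \<psi> p)
    (deriv (\<lambda>t. deriv (\<lambda>s. alpha_energy \<alpha> M A g (\<lambda>p. sgn (\<psi> p + (t + s) *\<^sub>R a))) 0) 0)"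
proof -
  have "norm (\<psi> p) = 1" if "p \<in> M" for p
    using \<psi> that by (auto simp: smooth_map_to_sphere_def Pi_iff)
  then have "((\<lambda>t. sgn (\<psi> p + t *\<^sub>R a)) has_vector_derivative a - (\<psi> p \<bullet> a) *\<^sub>R \<psi> p) (at 0)"
    if "p \<in> M" for p
    using has_vector_derivative_sgn_shift that by blast
  then show ?thesis
    unfolding second_variation_def
    by (intro exI[of _ "1/4"] exI[of _ "\<lambda>t s p. sgn (\<psi> p + (t + s) *\<^sub>R a)"])
      (use smooth_variation2_sgn_shift[OF A \<psi> a] in simp)
qed

section \<open>Averaging the second variation over an orthonormal basis\<close>

theorem theorem13:
  fixes M :: "('a::t2_space) set"
    and A :: "('a, 'm::{finite, wellorder}) chart set"
    and g :: "('a, 'm) metric"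
    and \<psi> :: "'a \<Rightarrow> 'b::euclidean_space"
    and \<alpha> :: real
    and n :: nat
  assumes "\<alpha> > 1"
    and "compact M"
    and "smooth_atlas M A"
    and "riemannian_metric A g"
    and "DIM('b) = n + 1"
    and "alpha_harmonic \<alpha> M A g \<psi>"
    and "\<exists>p\<in>M. norm_sq_differential A g \<psi> p \<noteq> 0"
    and "\<forall>p\<in>M. norm_sq_differential A g \<psi> p < (real n - 2) / (2 * \<alpha> - real n)"
  shows "unstable \<alpha> M A g \<psi>"
proof
  assume stable: "stable \<alpha> M A g \<psi>"
  note M = assms(2) and A = assms(3) and g = assms(4)
  let ?K = "(real n - 2) / (2 * \<alpha> - real n)"
  let ?\<mu> = "riemannian_volume M A g"
  let ?e = "norm_sq_differential A g \<psi>"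
  let ?f = "\<lambda>b p. \<psi> p \<bullet> b"
  let ?q = "\<lambda>b. norm_sq_differential A g (?f b)"
  have \<psi>: "smooth_map_to_sphere M A \<psi>" using assms(6) by (simp add: alpha_harmonic_def)
  then have sm: "smooth_in_charts A \<psi>"
    by (simp add: smooth_map_to_sphere_def smooth_in_charts_def)
  have un: "norm (\<psi> p) = 1" if "p \<in> M" for p
    using \<psi> that by (auto simp: smooth_map_to_sphere_def Pi_iff)
  note smf = smooth_in_charts_inner_const[OF A sm]
  have vol: "is_riemannian_volume M A g ?\<mu>" by (rule riemannian_volume[OF M A g])
  note space = space_riemannian_volume[OF vol]
  interpret finite_measure ?\<mu> by (rule finite_riemannian_volume[OF M A g vol])
  have e0: "0 \<le> ?e p" if "p \<in> M" for p
    by (rule norm_sq_differential_nonneg[OF A g sm that])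
  have eK: "?e p < ?K" if "p \<in> M" for p using assms(8) that by blast
  \<comment> \<open>Strictness rests on such a point: where \<open>?e\<close> vanishes, the averaged
    integrand vanishes as well.\<close>
  obtain p0 where p0: "p0 \<in> M" "?e p0 \<noteq> 0" using assms(7) by blast
  have "0 < ?K" using e0[OF p0(1)] eK[OF p0(1)] by simp
  \<comment> \<open>A positive quotient could also have both signs reversed, but n < 2 together with
    2 \<alpha> < n contradicts \<alpha> > 1.\<close>
  then have n: "real n < 2 * \<alpha>"
    using assms(1) by (auto simp: zero_less_divide_iff)
  have neg: "(2 * \<alpha> - real n) * ?e p < real n - 2" if "p \<in> M" for p
    using eK[OF that] n by (simp add: pos_less_divide_eq mult.commute)
  have meas: "h \<in> borel_measurable ?\<mu>" if "continuous_on M h" for h :: "'a \<Rightarrow> real"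
  proof -
    have "sets ?\<mu> = sets (restrict_space borel M)" using vol by (simp add: is_riemannian_volume_def)
    then show ?thesis
      using borel_measurable_continuous_on_restrict[OF that] measurable_cong_sets by blast
  qed
  have me: "?e \<in> borel_measurable ?\<mu>" and mq: "?q b \<in> borel_measurable ?\<mu>"
    and mf: "?f b \<in> borel_measurable ?\<mu>" for b
    by (intro meas continuous_on_norm_sq_differential[OF A g] sm smf smooth_in_charts_imp_continuous_on[OF A])+
  have q0: "0 \<le> ?q b p" if "p \<in> M" for b p
    by (rule norm_sq_differential_nonneg[OF A g smf that])
  have qe: "?q b p \<le> ?e p" if "b \<in> Basis" "p \<in> M" for b p
    unfolding norm_sq_differential_sum_Basis[OF A g sm that(2), symmetric]
    using that q0 by (intro member_le_sum) auto
  have f1: "\<bar>?f b p\<bar> \<le> 1" if "b \<in> Basis" "p \<in> M" for b p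
    using Basis_le_norm[OF that(1), of "\<psi> p"] un[OF that(2)] by simp
  have second: "0 \<le> (\<integral>p. alpha_dens2 \<alpha> (?e p) (?q b p) (?f b p) 0 \<partial>?\<mu>)"
    and int: "integrable ?\<mu> (\<lambda>p. alpha_dens2 \<alpha> (?e p) (?q b p) (?f b p) 0)" if b: "b \<in> Basis" for b
  proof -
    define G where "G t = alpha_energy \<alpha> M A g (\<lambda>p. sgn (\<psi> p + t *\<^sub>R b))" for t
    have nb: "norm b = 1" using b by simp
    have G: "G t = (\<integral>p. alpha_dens \<alpha> (?e p) (?q b p) (?f b p) t \<partial>?\<mu>)" if t: "\<bar>t\<bar> < 1/4" for t
      unfolding G_def alpha_energy_def
    proof (rule Bochner_Integration.integral_cong[OF refl])
      fix p assume "p \<in> space ?\<mu>"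
      then have p: "p \<in> M" by (simp add: space)
      have "\<bar>t\<bar> < 1" using t by simp
      from norm_sq_differential_sgn_shift[OF A g sm un nb this p refl]
      show "(1 + norm_sq_differential A g (\<lambda>p. sgn (\<psi> p + t *\<^sub>R b)) p) powr \<alpha> =
          alpha_dens \<alpha> (?e p) (?q b p) (?f b p) t"
        by (simp add: alpha_dens_def shift_dens_def shift_nsq_def)
    qed
    \<comment> \<open>The hypothesis on the differential doubles as the uniform upper bound
      \<open>?K\<close> on \<open>?e\<close> that domination requires.\<close>
    have "deriv (\<lambda>t. deriv (\<lambda>s. G (t + s)) 0) 0 =
        (\<integral>p. alpha_dens2 \<alpha> (?e p) (?q b p) (?f b p) 0 \<partial>?\<mu>) \<and>
      integrable ?\<mu> (\<lambda>p. alpha_dens2 \<alpha> (?e p) (?q b p) (?f b p) 0)"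
      using q0 qe[OF b] f1[OF b] eK
      by (intro conjI deriv_deriv_integral_alpha_dens[OF finite_measure_axioms me mq mf, where K = ?K] G)
        (auto simp: space less_imp_le)
    moreover have "compactly_supported M (\<lambda>p. b - (\<psi> p \<bullet> b) *\<^sub>R \<psi> p)"
      unfolding compactly_supported_def by (intro compact_Int_closed M closed_closure)
    then have "0 \<le> deriv (\<lambda>t. deriv (\<lambda>s. G (t + s)) 0) 0"
      using stable vector_field_along_projection[OF A \<psi>] second_variation_projection[OF A \<psi> nb]
      unfolding stable_def G_def by blast
    ultimately show "0 \<le> (\<integral>p. alpha_dens2 \<alpha> (?e p) (?q b p) (?f b p) 0 \<partial>?\<mu>)"
      "integrable ?\<mu> (\<lambda>p. alpha_dens2 \<alpha> (?e p) (?q b p) (?f b p) 0)" by simp_all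
  qed
  let ?S = "\<lambda>p. \<Sum>b\<in>Basis. alpha_dens2 \<alpha> (?e p) (?q b p) (?f b p) 0"
  have S: "?S p = 2 * \<alpha> * (1 + ?e p) powr (\<alpha> - 2) * (?e p * ((2 * \<alpha> - real n) * ?e p - (real n - 2)))"
    if p: "p \<in> M" for p
  proof -
    have "(\<Sum>b\<in>Basis. (?f b p)\<^sup>2) = 1"
      using un[OF p] euclidean_inner[of "\<psi> p" "\<psi> p"] by (simp add: power2_eq_square dot_square_norm)
    moreover have "(\<Sum>b\<in>Basis. ?q b p) = ?e p" by (rule norm_sq_differential_sum_Basis[OF A g sm p])
    moreover have "?S p = 2 * \<alpha> * (1 + ?e p) powr (\<alpha> - 2) *
      (2 * (\<alpha> - 1) * (?e p)\<^sup>2 * (\<Sum>b\<in>Basis. (?f b p)\<^sup>2) +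
       (1 + ?e p) * (4 * ?e p * (\<Sum>b\<in>Basis. (?f b p)\<^sup>2) - real DIM('b) * ?e p - (\<Sum>b\<in>Basis. ?q b p)))"
      unfolding alpha_dens2_0[OF e0[OF p]] sum_distrib_left[symmetric] sum.distrib sum_subtractf
      by simp
    ultimately have "?S p = 2 * \<alpha> * (1 + ?e p) powr (\<alpha> - 2) *
      (2 * (\<alpha> - 1) * (?e p)\<^sup>2 + (1 + ?e p) * (4 * ?e p - real (n + 1) * ?e p - ?e p))"
      using assms(5) by simp
    \<comment> \<open>The n + 1 basis vectors contribute -(n + 1) e, the f^2 contribute 4 e and the
      q contribute -e: together (2 - n) e, the origin of n - 2. Multiplied by 1 + e and joined by 2
      (\<alpha> - 1) e^2, this gives e^2 the coefficient 2 \<alpha> - n.\<close>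
    also have "2 * (\<alpha> - 1) * (?e p)\<^sup>2 + (1 + ?e p) * (4 * ?e p - real (n + 1) * ?e p - ?e p) =
      ?e p * ((2 * \<alpha> - real n) * ?e p - (real n - 2))"
      by (simp add: algebra_simps power2_eq_square)
    finally show ?thesis .
  qed
  have pos: "2 * \<alpha> * (1 + ?e p) powr (\<alpha> - 2) > 0" if "p \<in> M" for p
    using e0[OF that] assms(1) by simp
  have S_neg: "?S p < 0" if "p \<in> M" "?e p \<noteq> 0" for p
    unfolding S[OF that(1)] using pos[OF that(1)] neg[OF that(1)] e0[OF that(1)] that(2)
    by (intro mult_pos_neg) auto
  have S_le: "?S p \<le> 0" if "p \<in> M" for p
    using S_neg[OF that] S[OF that] by (cases "?e p = 0") auto
  \<comment> \<open>On this set the averaged integrand is strictly negative; being open and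
    nonempty, it has positive volume.\<close>
  let ?U = "{p \<in> M. ?e p \<noteq> 0}"
  have "openin (top_of_set M) (M \<inter> ?e -` (- {0}))"
    by (rule continuous_openin_preimage_gen[OF continuous_on_norm_sq_differential[OF A g sm]]) auto
  also have "M \<inter> ?e -` (- {0}) = ?U" by auto
  finally have oU: "openin (top_of_set M) ?U" .
  then have U: "emeasure ?\<mu> ?U \<noteq> 0"
    using riemannian_volume_open_pos[OF A g vol] p0 by blast
  have "?U \<in> sets ?\<mu>"
    using oU vol by (auto simp: is_riemannian_volume_def sets_restrict_space openin_open)
  then have "(\<integral>p. ?S p \<partial>?\<mu>) < (\<integral>p. 0 \<partial>?\<mu>)"
    using U
  proof (intro integral_less_AE[of _ _ ?U])
    show "AE p in ?\<mu>. p \<in> ?U \<longrightarrow> ?S p \<noteq> 0"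
      by (rule AE_I2) (blast dest: less_imp_neq[OF S_neg])
    show "AE p in ?\<mu>. ?S p \<le> 0" by (rule AE_I2) (rule S_le, simp only: space)
    show "integrable ?\<mu> ?S" by (rule Bochner_Integration.integrable_sum) (rule int)
  qed simp_all
  moreover have "(\<integral>p. ?S p \<partial>?\<mu>) = (\<Sum>b\<in>Basis. \<integral>p. alpha_dens2 \<alpha> (?e p) (?q b p) (?f b p) 0 \<partial>?\<mu>)"
    by (rule Bochner_Integration.integral_sum[OF int])
  ultimately show False
    using sum_nonneg[of Basis "\<lambda>b. \<integral>p. alpha_dens2 \<alpha> (?e p) (?q b p) (?f b p) 0 \<partial>?\<mu>"] second by simp
qed

end
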